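(* Let $\alpha\in(1/2,1)\cup(1,\infty)$. Let $Q_1$ be a positive definite matrix in $\mathcal{D}_d$ (i.e. $Q_1\in\mathrm{relint}(\mathcal{D}_d)$), and define $Q_{t+1}=T_F\left(Q_t^{1-\alpha}\right)^{1/(1-\alpha)}$ for every $t\in\mathbb{N}=\{1,2,\dots\}$. Let $Q_\star$ be the minimizer of $F$ over $\mathcal{D}_d$. Then for every $T\in\mathbb{N}$, $$F\left(\frac{Q_{T+1}}{\mathrm{Tr}[Q_{T+1}]}\right)-F(Q_\star)\leq\left|\frac{1}{\alpha-1}\right| d_{\mathrm{T}}\left(Q_\star^{1-\alpha},\left(\frac{Q_{T+1}}{\mathrm{Tr}[Q_{T+1}]}\right)^{1-\alpha}\right)\leq\left|\frac{2}{\alpha-1}\right|\cdot\left|1-\frac1\alpha\right|^{T} d_{\mathrm{T}}\left(Q_\star^{1-\alpha},Q_1^{1-\alpha}\right).$$ Moreover, if $\alpha>1$, the function values are non-increasing: $$F\left(\frac{Q_{t+1}}{\mathrm{Tr}[Q_{t+1}]}\right)\leq F\left(\frac{Q_t}{\mathrm{Tr}[Q_t]}\right)\quad\text{for all } t\in\mathbb{N}.$$ Furthermore, the quantity $d_{\mathrm{T}}\left(Q_\star^{1-\alpha},Q_1^{1-\alpha}\right)$ is finite.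
   Context: $\mathcal{B}_d$ is the set of Hermitian matrices in $\mathbb{C}^{d\times d}$; $\mathcal{B}_{d,+}$ and $\mathcal{B}_{d,++}$ are the subsets of positive semi-definite and positive definite matrices; $\mathcal{D}_d=\{Q\in\mathcal{B}_{d,+}:\mathrm{Tr}[Q]=1\}$ is the set of quantum states. $U\le V$ means $V-U$ is positive semi-definite. Powers of Hermitian matrices are defined through the eigendecomposition. Standing data: $A_1,\dots,A_n\in\mathcal{D}_d$ with $\sum_{j=1}^n A_j$ full-rank, and weights $w[j]>0$ with $\sum_{j=1}^n w[j]=1$. For $A\in\mathcal{D}_d$ and $Q\in\mathcal{B}_{d,+}$, the Petz-Rényi divergence of order $\alpha\in(0,1)\cup(1,\infty)$ is $D_\alpha(A\|Q)=\frac{1}{\alpha-1}\log\left(\mathrm{Tr}[A^\alpha Q^{1-\alpha}]\right)$ whenever the right-hand side is well-defined, and $+\infty$ otherwise. The objective is $F(Q)=\sum_{j=1}^n w[j]\,D_\alpha(A_j\|Q)$; its minimizer over $\mathcal{D}_d$ (the Petz-Augustin mean) exists, is unique and is positive definite. The operator $T_F:\mathcal{B}_{d,++}\to\mathcal{B}_{d,++}$ is $$T_F(U)=\left(\sum_{j=1}^n w[j]\frac{A_j^\alpha}{\mathrm{Tr}[A_j^\alpha U]}\right)^{(1-\alpha)/\alpha}.$$ The Thompson metric on $\mathcal{B}_{d,++}$ is $d_{\mathrm{T}}(V,U)=\inf\{r\ge0: e^{-r}V\le U\le e^{r}V\}$. *)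

theory Defs
  imports "HOL-Analysis.Analysis"
begin

type_synonym 'n cmat = "complex ^ 'n ^ 'n"

definition adj :: "'n::finite cmat \<Rightarrow> 'n cmat" where
  "adj A = (\<chi> i j. cnj (A $ j $ i))"

definition hermitian :: "'n::finite cmat \<Rightarrow> bool" where
  "hermitian A \<longleftrightarrow> adj A = A"

definition unitary :: "'n::finite cmat \<Rightarrow> bool" where
  "unitary U \<longleftrightarrow> adj U ** U = mat 1 \<and> U ** adj U = mat 1"

definition real_diag :: "('n::finite \<Rightarrow> real) \<Rightarrow> 'n cmat" where
  "real_diag l = (\<chi> i j. if i = j then complex_of_real (l i) else 0)"

(* For Hermitian A the number x* A x is real, so taking Re loses nothing. *)
definition quad_form :: "'n::finite cmat \<Rightarrow> complex ^ 'n \<Rightarrow> real" where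
  "quad_form A x = Re (\<Sum>i\<in>UNIV. cnj (x $ i) * (A *v x) $ i)"

definition psd :: "'n::finite cmat \<Rightarrow> bool" where
  "psd A \<longleftrightarrow> hermitian A \<and> (\<forall>x. 0 \<le> quad_form A x)"

definition posdef :: "'n::finite cmat \<Rightarrow> bool" where
  "posdef A \<longleftrightarrow> hermitian A \<and> (\<forall>x. x \<noteq> 0 \<longrightarrow> 0 < quad_form A x)"

definition loewner_le :: "'n::finite cmat \<Rightarrow> 'n cmat \<Rightarrow> bool" (infix "\<preceq>" 50) where
  "U \<preceq> V \<longleftrightarrow> psd (V - U)"

definition states :: "'n::finite cmat set" where
  "states = {Q. psd Q \<and> trace Q = 1}"

(* Power through an eigendecomposition A = U diag(l) U*; lemma mat_powr_eigendecomposition shows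
   that the value does not depend on the decomposition. Only used for positive semi-definite A.
   Since 0 powr p = 0, a power of a singular A is taken on the support of A and is 0 on its
   kernel. *)
definition mat_powr :: "'n::finite cmat \<Rightarrow> real \<Rightarrow> 'n cmat" where
  "mat_powr A p = (THE B. \<exists>U l. unitary U \<and> A = U ** real_diag l ** adj U \<and>
                            B = U ** real_diag (\<lambda>i. l i powr p) ** adj U)"

(* Tr[A^alpha Q^(1-alpha)]; it is real for positive semi-definite A and Q. *)
definition petz_trace :: "real \<Rightarrow> 'n::finite cmat \<Rightarrow> 'n cmat \<Rightarrow> real" where
  "petz_trace \<alpha> A Q = Re (trace (mat_powr A \<alpha> ** mat_powr Q (1 - \<alpha>)))"

(* The right-hand side is well-defined iff the trace is positive and, for alpha > 1 (where a
   negative power of Q occurs), ker Q is contained in ker A. *)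
definition petz_renyi :: "real \<Rightarrow> 'n::finite cmat \<Rightarrow> 'n cmat \<Rightarrow> ereal" where
  "petz_renyi \<alpha> A Q =
     (if petz_trace \<alpha> A Q > 0 \<and> (\<alpha> > 1 \<longrightarrow> (\<forall>x. Q *v x = 0 \<longrightarrow> A *v x = 0))
      then ereal (1 / (\<alpha> - 1) * ln (petz_trace \<alpha> A Q)) else \<infinity>)"

definition petz_augustin_objective ::
    "nat \<Rightarrow> (nat \<Rightarrow> real) \<Rightarrow> (nat \<Rightarrow> 'n::finite cmat) \<Rightarrow> real \<Rightarrow> 'n cmat \<Rightarrow> ereal" where
  "petz_augustin_objective n w A \<alpha> Q = (\<Sum>j=1..n. ereal (w j) * petz_renyi \<alpha> (A j) Q)"

definition petz_augustin_operator ::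
    "nat \<Rightarrow> (nat \<Rightarrow> real) \<Rightarrow> (nat \<Rightarrow> 'n::finite cmat) \<Rightarrow> real \<Rightarrow> 'n cmat \<Rightarrow> 'n cmat" where
  "petz_augustin_operator n w A \<alpha> U =
     mat_powr (\<Sum>j=1..n. (w j / Re (trace (mat_powr (A j) \<alpha> ** U))) *\<^sub>R mat_powr (A j) \<alpha>)
       ((1 - \<alpha>) / \<alpha>)"

(* Extended-real valued: the infimum of the empty set is \<infinity>, so finiteness is a genuine claim. *)
definition thompson :: "'n::finite cmat \<Rightarrow> 'n cmat \<Rightarrow> ereal" where
  "thompson V U = (INF r\<in>{r::real. 0 \<le> r \<and> exp (- r) *\<^sub>R V \<preceq> U \<and> U \<preceq> exp r *\<^sub>R V}. ereal r)"

definition trace_normalize :: "'n::finite cmat \<Rightarrow> 'n cmat" where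
  "trace_normalize Q = (1 / Re (trace Q)) *\<^sub>R Q"

lemma real_diag_mult_left: "(real_diag l ** M) $ i $ j = complex_of_real (l i) * M $ i $ j"
proof -
  have "(real_diag l ** M) $ i $ j = (\<Sum>k\<in>UNIV. if i = k then complex_of_real (l i) * M $ k $ j else 0)"
    unfolding matrix_matrix_mult_def real_diag_def vec_lambda_beta by (rule sum.cong) auto
  then show ?thesis by simp
qed

lemma real_diag_mult_right: "(M ** real_diag l) $ i $ j = M $ i $ j * complex_of_real (l j)"
proof -
  have "(M ** real_diag l) $ i $ j = (\<Sum>k\<in>UNIV. if k = j then M $ i $ k * complex_of_real (l k) else 0)"
    unfolding matrix_matrix_mult_def real_diag_def vec_lambda_beta by (rule sum.cong) auto
  then show ?thesis by simp
qed

lemma mat_powr_eigendecomposition: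
  assumes U: "unitary U"
  shows "mat_powr (U ** real_diag l ** adj U) p = U ** real_diag (\<lambda>i. l i powr p) ** adj U"
  unfolding mat_powr_def
proof (rule the_equality)
  fix B
  assume "\<exists>V m. unitary V \<and> U ** real_diag l ** adj U = V ** real_diag m ** adj V \<and>
            B = V ** real_diag (\<lambda>i. m i powr p) ** adj V"
  then obtain V m where V: "unitary V"
    and eq: "U ** real_diag l ** adj U = V ** real_diag m ** adj V"
    and B: "B = V ** real_diag (\<lambda>i. m i powr p) ** adj V" by blast
  have uU: "adj U ** U = mat 1" "U ** adj U = mat 1"
    and uV: "adj V ** V = mat 1" "V ** adj V = mat 1"
    using U V by (auto simp: unitary_def)
  define W where "W = adj V ** U"
  have "W ** real_diag l = adj V ** (U ** real_diag l ** adj U) ** U"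
    unfolding W_def by (metis matrix_mul_assoc uU(1) matrix_mul_rid)
  also have "\<dots> = real_diag m ** W"
    unfolding eq W_def by (metis matrix_mul_assoc uV(1) matrix_mul_lid)
  finally have WD: "W ** real_diag l = real_diag m ** W" .
  have "W $ i $ j * complex_of_real (l j) = complex_of_real (m i) * W $ i $ j" for i j
    using real_diag_mult_right[of W l i j] real_diag_mult_left[of m W i j] WD by metis
  then have "W $ i $ j = 0 \<or> l j = m i" for i j
    by (metis mult.commute mult_cancel_left of_real_eq_iff)
  then have "W $ i $ j * complex_of_real (l j powr p) = complex_of_real (m i powr p) * W $ i $ j" for i j
    by (metis mult.commute mult_zero_left)
  then have WDp: "W ** real_diag (\<lambda>i. l i powr p) = real_diag (\<lambda>i. m i powr p) ** W"
    by (simp add: vec_eq_iff real_diag_mult_left real_diag_mult_right)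
  have "B = V ** (real_diag (\<lambda>i. m i powr p) ** W) ** adj U"
    unfolding B W_def by (metis matrix_mul_assoc uU(2) matrix_mul_rid)
  also have "\<dots> = U ** real_diag (\<lambda>i. l i powr p) ** adj U"
    unfolding WDp[symmetric] unfolding W_def by (metis matrix_mul_assoc uV(2) matrix_mul_lid)
  finally show "B = U ** real_diag (\<lambda>i. l i powr p) ** adj U" .
qed (use U in blast)

end

theory Submission
  imports Defs
begin

text \<open>In the variable U = Q^(1-\<alpha>) the iteration reads U' = T U with
  T U = (S U)^((1-\<alpha>)/\<alpha>) and S U the sum of w_j A_j^\<alpha> / Tr[A_j^\<alpha> U]. The map S is nonexpansive in the Thompson metric, since it reverses the
  order and is homogeneous of degree -1, and by the Loewner-Heinz inequality the power contracts by
  the factor |1 - 1/\<alpha>| < 1. The objective is G U / (\<alpha>-1), where G is 1-Lipschitz for the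
  Thompson metric; normalizing the trace at most doubles the distance to a trace-one fixed point,
  because U \<mapsto> Tr U^(1/(1-\<alpha>)) is monotone.

  That minimizers are fixed points is obtained without differentiating the objective. For \<alpha> < 1
  the contraction has a fixed point, and concavity of the logarithm with Young's trace inequality
  Tr[X^\<alpha> Q^(1-\<alpha>)] \<le> \<alpha> Tr X + (1-\<alpha>) Tr Q shows that it is the only minimizer. For
  \<alpha> > 1 the inequality is reversed and makes every step decrease the objective, so at a minimizer
  equality holds, which forces X = Q.\<close>

section \<open>Spectral theorem\<close>

text \<open>The sign of \<alpha> - 1 decides which argument is available. Jensen bounds
  \<open>G V - G U\<close> from above by ln Tr[(S U) V]. For \<alpha> < 1 the objective is a
  negative multiple of \<open>G\<close>, so at a fixed point U this controls every competitor of
  finite objective, singular ones included; hence the existence of a fixed point has to come first.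
  For \<alpha> > 1 the multiple is positive and the bound serves only a single step from Q to X = (S
  (Q^(1-\<alpha>)))^(1/\<alpha>). There finiteness of the objective already makes a minimizer
  positive definite, since the kernels of the A_j meet only in 0. The range \<alpha> > 1/2 is
  exactly |1 - 1/\<alpha>| < 1 for positive \<alpha>. The trace inequalities reduce to scalar ones:
  in eigenbases of X and Q, Tr[f(X) g(Q)] is a sum of f(x_i) g(q_j) against a doubly stochastic
  matrix. Distances are handled through the relation \<open>thompson_near r\<close>, so that the
  infimum never has to be attained.\<close>

text \<open>The inner product \<open>\<bullet>\<close> of this type is only the real part of the
  Hermitian form; complex orthogonality needs the full form.\<close>

definition cdot :: "complex ^ 'n \<Rightarrow> complex ^ 'n \<Rightarrow> complex" where
  "cdot x y = (\<Sum>i\<in>UNIV. cnj (x $ i) * y $ i)"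

lemma Re_cdot: "Re (cdot x y) = x \<bullet> y"
  by (simp add: cdot_def inner_vec_def inner_complex_def)

lemma cnj_cdot: "cnj (cdot x y) = cdot y x"
  by (simp add: cdot_def mult.commute)

lemma cdot_add_right: "cdot x (y + z) = cdot x y + cdot x z"
  by (simp add: cdot_def sum.distrib distrib_left)

lemma cdot_scale_right: "cdot x (c *s y) = c * cdot x y"
  by (simp add: cdot_def sum_distrib_left mult_ac)

lemma cdot_scale_left: "cdot (c *s x) y = cnj c * cdot x y"
  by (simp add: cdot_def sum_distrib_left mult_ac)

lemma Im_cdot: "Im (cdot x y) = (\<i> *s x) \<bullet> y"
  by (simp add: Re_cdot[symmetric] cdot_scale_left)

lemma cdot_self: "cdot x x = complex_of_real ((norm x)\<^sup>2)"
proof (rule complex_eqI)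
  show "Re (cdot x x) = Re (complex_of_real ((norm x)\<^sup>2))"
    by (simp add: Re_cdot dot_square_norm)
  show "Im (cdot x x) = Im (complex_of_real ((norm x)\<^sup>2))"
    using cnj_cdot[of x x] by (simp add: complex_eq_iff)
qed

lemma cdot_adj: "cdot x (A *v y) = cdot (adj A *v x) y"
proof -
  have "cdot x (A *v y) = (\<Sum>i\<in>UNIV. \<Sum>j\<in>UNIV. cnj (x $ i) * (A $ i $ j * y $ j))"
    by (simp add: cdot_def matrix_vector_mult_def sum_distrib_left)
  also have "\<dots> = (\<Sum>j\<in>UNIV. \<Sum>i\<in>UNIV. cnj (x $ i) * (A $ i $ j * y $ j))"
    by (rule sum.swap)
  also have "\<dots> = cdot (adj A *v x) y"
    by (simp add: cdot_def matrix_vector_mult_def adj_def sum_distrib_right sum_distrib_left mult_ac)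
  finally show ?thesis .
qed

lemma inner_adj: "x \<bullet> (A *v y) = (adj A *v x) \<bullet> y"
  using cdot_adj[of x A y] by (metis Re_cdot)

lemma adj_adj [simp]: "adj (adj A) = A"
  by (simp add: adj_def vec_eq_iff)

lemma adj_mult: "adj (A ** B) = adj B ** adj A"
  by (simp add: adj_def vec_eq_iff matrix_matrix_mult_def mult.commute)

lemma adj_add: "adj (A + B) = adj A + adj B"
  by (simp add: adj_def vec_eq_iff)

lemma adj_diff: "adj (A - B) = adj A - adj B"
  by (simp add: adj_def vec_eq_iff)

lemma adj_scaleR: "adj (c *\<^sub>R A) = c *\<^sub>R adj A"
  by (simp add: adj_def vec_eq_iff)

lemma hermitian_inner: "hermitian A \<Longrightarrow> x \<bullet> (A *v y) = (A *v x) \<bullet> y"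
  by (simp add: inner_adj hermitian_def)

lemma matrix_vector_mult_scaleR_right:
  "(A :: complex ^ 'n ^ 'm) *v (c *\<^sub>R x) = c *\<^sub>R (A *v x)"
  by (simp add: vec_eq_iff matrix_vector_mult_def scaleR_sum_right)

lemma matrix_vector_mult_scaleR_left:
  "(c *\<^sub>R (A :: complex ^ 'n ^ 'm)) *v x = c *\<^sub>R (A *v x)"
  by (simp add: vec_eq_iff matrix_vector_mult_def scaleR_sum_right)

lemma matrix_mult_scaleR_left:
  "(c *\<^sub>R (A :: complex ^ 'n ^ 'm)) ** B = c *\<^sub>R (A ** B)"
  by (simp add: vec_eq_iff matrix_matrix_mult_def scaleR_sum_right)

lemma matrix_mult_scaleR_right:
  "(A :: complex ^ 'n ^ 'm) ** (c *\<^sub>R B) = c *\<^sub>R (A ** B)"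
  by (simp add: vec_eq_iff matrix_matrix_mult_def scaleR_sum_right)

lemma quad_form_inner: "quad_form A x = x \<bullet> (A *v x)"
  by (simp add: quad_form_def Re_cdot[symmetric] cdot_def)

lemma continuous_on_cdot: "continuous_on S (\<lambda>x. cdot a x)"
  unfolding cdot_def by (intro continuous_intros)

text \<open>First-order optimality without derivatives: for small negative t the linear term
  dominates.\<close>

lemma real_quadratic_zero:
  fixes a b :: real
  assumes "\<And>t. 0 \<le> 2 * t * a + t\<^sup>2 * b" "0 \<le> a"
  shows "a = 0"
proof (rule ccontr)
  assume "a \<noteq> 0"
  then have a: "a > 0" using assms(2) by simp
  \<comment> \<open>Small enough that |t b| \<le> a, so that 2 a + t b stays positive.\<close>
  define t where "t = - a / (\<bar>b\<bar> + 1)"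
  have t: "t < 0" using a by (simp add: t_def field_simps)
  then have "2 * a + t * b \<le> 0"
  proof -
    have "0 \<le> t * (2 * a + t * b)"
      using assms(1)[of t] by (simp add: power2_eq_square algebra_simps)
    then show ?thesis using t by (simp add: zero_le_mult_iff)
  qed
  moreover have "\<bar>t * b\<bar> \<le> a"
    using a by (simp add: t_def abs_mult field_simps)
  ultimately show False using a by linarith
qed

text \<open>Take x maximizing the quadratic form on the unit sphere of the orthogonal complement W
  of S. Since S consists of eigenvectors, A maps W into itself, so the residual h = A x - c x lies
  in W; moving x along h would increase the Rayleigh quotient to first order unless h = 0.\<close>

lemma hermitian_eigenvector_orthogonal:
  fixes A :: "complex ^ 'n::finite ^ 'n"
  assumes A: "hermitian A" and S: "finite S" "card S < CARD('n)"
    and eig: "\<And>s. s \<in> S \<Longrightarrow> \<exists>c. A *v s = complex_of_real c *s s"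
  shows "\<exists>x c. norm x = 1 \<and> A *v x = complex_of_real c *s x \<and> (\<forall>s\<in>S. cdot s x = 0)"
proof -
  define W where "W = {x. \<forall>s\<in>S. cdot s x = 0}"
  define K where "K = W \<inter> sphere 0 1"
  \<comment> \<open>Adjoining \<open>\<i> *s s\<close> makes real orthogonality to T the same as
    complex orthogonality to S. T has at most 2 card S elements, and the real dimension of the space
    is 2 CARD('n).\<close>
  define T where "T = S \<union> (\<lambda>s. \<i> *s s) ` S"
  have "card T \<le> card S + card S"
    unfolding T_def using S(1) by (meson card_Un_le card_image_le add_left_mono order_trans)
  moreover have "dim T \<le> card T"
    using S(1) by (intro dim_le_card) (auto simp: T_def span_superset)
  ultimately have "dim T < DIM(complex ^ 'n)" using S(2) by simp
  then obtain x0 where x0: "x0 \<noteq> 0" "\<And>y. y \<in> span T \<Longrightarrow> orthogonal x0 y"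
    using orthogonal_to_subspace_exists by blast
  have "cdot s x0 = 0" if "s \<in> S" for s
  proof (rule complex_eqI)
    show "Re (cdot s x0) = Re 0"
      using x0(2)[of s] that by (simp add: T_def span_base orthogonal_def Re_cdot inner_commute)
    show "Im (cdot s x0) = Im 0"
      using x0(2)[of "\<i> *s s"] that by (simp add: T_def span_base orthogonal_def Im_cdot inner_commute)
  qed
  moreover have W_scale: "c *s x \<in> W" if "x \<in> W" for c x
    using that by (simp add: W_def cdot_scale_right)
  have scaleR: "c *\<^sub>R x = complex_of_real c *s x" for c and x :: "complex ^ 'n"
    by (simp add: vec_eq_iff) (simp add: scaleR_conv_of_real)
  ultimately have "(1 / norm x0) *\<^sub>R x0 \<in> W"
    unfolding scaleR by (simp add: W_def cdot_scale_right)
  then have "(1 / norm x0) *\<^sub>R x0 \<in> K"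
    using x0(1) by (simp add: K_def)
  then have K_ne: "K \<noteq> {}" by blast
  have "closed W"
    unfolding W_def by (intro closed_Collect_all closed_Collect_imp closed_Collect_eq continuous_on_cdot
      continuous_on_const open_Collect_const[of "_ \<in> S"] | subst Ball_def)+
  then have K_cpt: "compact K"
    unfolding K_def by (metis compact_Int_closed compact_sphere inf_commute)
  have "continuous_on K (\<lambda>x. x \<bullet> (A *v x))"
    by (intro continuous_intros)
  then obtain x where xK: "x \<in> K" and xmax: "\<And>y. y \<in> K \<Longrightarrow> y \<bullet> (A *v y) \<le> x \<bullet> (A *v x)"
    using continuous_attains_sup[OF K_cpt K_ne] by blast
  define c where "c = x \<bullet> (A *v x)"
  have nx: "norm x = 1" and xW: "x \<in> W" using xK by (auto simp: K_def)
  have W_add: "x + y \<in> W" if "x \<in> W" "y \<in> W" for x y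
    using that by (simp add: W_def cdot_add_right)
  have W_A: "A *v y \<in> W" if "y \<in> W" for y
  proof -
    have "cdot s (A *v y) = 0" if s: "s \<in> S" for s
    proof -
      have "cdot s (A *v y) = cdot (A *v s) y"
        using A by (simp add: cdot_adj hermitian_def)
      then show ?thesis
        using eig[OF s] \<open>y \<in> W\<close> s by (auto simp: W_def cdot_scale_left)
    qed
    then show ?thesis by (simp add: W_def)
  qed
  have le: "y \<bullet> (A *v y) \<le> c * (norm y)\<^sup>2" if "y \<in> W" for y
  proof (cases "y = 0")
    case False
    define z where "z = (1 / norm y) *\<^sub>R y"
    have "z \<in> K"
      using False W_scale[OF that] by (simp add: K_def z_def) (simp add: scaleR)
    then have "z \<bullet> (A *v z) \<le> c" using xmax c_def by blast
    then show ?thesis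
      using False by (simp add: z_def matrix_vector_mult_scaleR_right field_simps power2_eq_square)
  qed simp
  define h where "h = A *v x - c *\<^sub>R x"
  have h: "h = A *v x + complex_of_real (- c) *s x" by (simp add: h_def scaleR)
  have hW: "h \<in> W" unfolding h by (intro W_add W_A W_scale xW)
  have Ax: "A *v x = h + c *\<^sub>R x" by (simp add: h_def)
  have xh: "x \<bullet> h = 0"
    using nx by (simp add: h_def c_def inner_diff_right dot_square_norm)
  \<comment> \<open>This is \<open>le\<close> at x + t h; the constant terms cancel because |x| = 1
    and x is orthogonal to h.\<close>
  have quad: "0 \<le> 2 * t * - (h \<bullet> h) + t\<^sup>2 * (c * (h \<bullet> h) - h \<bullet> (A *v h))" for t
  proof -
    have "x + t *\<^sub>R h \<in> W" using W_add xW hW W_scale by (simp add: scaleR)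
    from le[OF this] have *: "(x + t *\<^sub>R h) \<bullet> (A *v (x + t *\<^sub>R h)) \<le> c * ((x + t *\<^sub>R h) \<bullet> (x + t *\<^sub>R h))"
      by (simp add: dot_square_norm)
    have "x \<bullet> (A *v h) = (h + c *\<^sub>R x) \<bullet> h"
      using hermitian_inner[OF A] Ax by metis
    then have xAh: "x \<bullet> (A *v h) = h \<bullet> h" by (simp add: inner_add_left xh)
    have hAx: "h \<bullet> (A *v x) = h \<bullet> h"
      using xh by (simp add: Ax inner_add_right inner_commute)
    have hx: "h \<bullet> x = 0" using xh by (simp add: inner_commute)
    have xx: "x \<bullet> x = 1" using nx by (simp add: dot_square_norm)
    have 1: "(x + t *\<^sub>R h) \<bullet> (A *v (x + t *\<^sub>R h)) = c + 2 * t * (h \<bullet> h) + t * (t * (h \<bullet> (A *v h)))"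
      by (simp only: matrix_vector_right_distrib matrix_vector_mult_scaleR_right inner_add_left
          inner_add_right inner_scaleR_left inner_scaleR_right xAh hAx c_def) (simp only: algebra_simps mult_2)
    have 2: "(x + t *\<^sub>R h) \<bullet> (x + t *\<^sub>R h) = 1 + t * (t * (h \<bullet> h))"
      by (simp add: inner_add_left inner_add_right xh hx xx)
    show ?thesis using *[unfolded 1 2]
      by (simp add: power2_eq_square right_diff_distrib distrib_left mult_ac)
  qed
  \<comment> \<open>The change from t to - t gives the linear term the nonnegative coefficient that
    \<open>real_quadratic_zero\<close> asks for.\<close>
  have "0 \<le> 2 * t * (h \<bullet> h) + t\<^sup>2 * (c * (h \<bullet> h) - h \<bullet> (A *v h))" for t
    using quad[of "- t"] by simp
  from real_quadratic_zero[OF this] have "h = 0" by simp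
  then have "A *v x = complex_of_real c *s x"
    by (simp add: Ax scaleR)
  then show ?thesis using nx xW unfolding W_def by blast
qed

theorem hermitian_eigendecomposition:
  fixes A :: "complex ^ 'n::finite ^ 'n"
  assumes A: "hermitian A"
  obtains P l where "unitary P" "A = P ** real_diag l ** adj P"
proof -
  \<comment> \<open>The orthonormal eigenvectors are indexed by subsets of the matrix index type, so
    the family for \<open>UNIV\<close> is already the list of columns of P.\<close>
  have "\<exists>f l. (\<forall>i\<in>I. A *v f i = complex_of_real (l i) *s f i) \<and>
          (\<forall>i\<in>I. \<forall>j\<in>I. cdot (f i) (f j) = (if i = j then 1 else 0))" for I :: "'n set"
    using finite[of I]
  proof (induction I rule: finite_induct)
    case empty
    show ?case by simp
  next
    case (insert k I)
    from insert.IH obtain f l where f: "\<And>i. i \<in> I \<Longrightarrow> A *v f i = complex_of_real (l i) *s f i"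
      and o: "\<And>i j. i \<in> I \<Longrightarrow> j \<in> I \<Longrightarrow> cdot (f i) (f j) = (if i = j then 1 else 0)" by blast
    have "card (f ` I) \<le> card I" by (simp add: card_image_le)
    also have "\<dots> < CARD('n)"
      using insert.hyps(2) by (intro psubset_card_mono) auto
    finally have "\<exists>x c. norm x = 1 \<and> A *v x = complex_of_real c *s x \<and> (\<forall>s\<in>f ` I. cdot s x = 0)"
      using f by (intro hermitian_eigenvector_orthogonal[OF A]) auto
    then obtain x c where x: "norm x = 1" "A *v x = complex_of_real c *s x"
      "\<And>i. i \<in> I \<Longrightarrow> cdot (f i) x = 0"
      by blast
    have xx: "cdot x x = 1" by (simp add: cdot_self x(1))
    have xf: "cdot x (f i) = 0" if "i \<in> I" for i
      using x(3)[OF that] by (metis cnj_cdot complex_cnj_zero)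
    show ?case
      using insert.hyps(2) by (intro exI[of _ "f(k := x)"] exI[of _ "l(k := c)"]) (auto simp: f o x xx xf)
  qed
  from this[of UNIV] obtain f :: "'n \<Rightarrow> complex ^ 'n" and l where "\<forall>i. A *v f i = complex_of_real (l i) *s f i"
    and "\<forall>i j. cdot (f i) (f j) = (if i = j then 1 else 0)" by auto
  then have f: "A *v f i = complex_of_real (l i) *s f i"
    and o: "cdot (f i) (f j) = (if i = j then 1 else 0)" for i j by simp_all
  define P where "P = (\<chi> i j. f j $ i)"
  have "adj P ** P = mat 1"
    using o by (simp add: vec_eq_iff P_def adj_def matrix_matrix_mult_def mat_def cdot_def)
  then have P: "unitary P"
    by (simp add: unitary_def matrix_left_right_inverse)
  have "A ** P = P ** real_diag l"
  proof -
    have "(A ** P) $ i $ j = (A *v f j) $ i" for i j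
      by (simp add: P_def matrix_matrix_mult_def matrix_vector_mult_def)
    then show ?thesis
      by (simp add: vec_eq_iff real_diag_mult_right f P_def mult.commute)
  qed
  then have "A = P ** real_diag l ** adj P"
    using P by (metis matrix_mul_assoc matrix_mul_rid unitary_def)
  with P that show ?thesis by blast
qed

lemma full_rank_kernel:
  fixes A :: "complex ^ 'n::finite ^ 'n"
  assumes "rank A = CARD('n)" "A *v x = 0"
  shows "x = 0"
proof -
  have "vec.dim (rows A) = vec.dim (UNIV :: (complex ^ 'n) set)"
    using assms(1) by (simp add: row_rank_def_gen vec.dim_UNIV vec.dimension_def card_cart_basis)
  then have "vec.span (rows A) = UNIV"
    by (metis vec.dim_eq_full vec.dim_UNIV vec.dimension_def)
  then obtain B where "B ** A = mat 1"
    using matrix_left_invertible_span_rows_gen by blast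
  then show ?thesis
    using assms(2) by (metis matrix_vector_mul_assoc matrix_vector_mul_lid matrix_vector_mult_0_right)
qed

section \<open>Spectral calculus and the Loewner order\<close>

text \<open>Functional calculus with the eigenbasis kept explicit: for a fixed unitary P, products,
  powers, scalings and traces act on f alone.\<close>

definition spec :: "complex ^ 'n::finite ^ 'n \<Rightarrow> ('n \<Rightarrow> real) \<Rightarrow> complex ^ 'n ^ 'n" where
  "spec P f = P ** real_diag f ** adj P"

lemma hermitian_obtain_spec:
  assumes "hermitian A"
  obtains P l where "unitary P" "A = spec P l"
  using hermitian_eigendecomposition[OF assms] unfolding spec_def by metis

lemma unitaryD:
  assumes "unitary P"
  shows "adj P ** P = mat 1" "P ** adj P = mat 1"
  using assms by (auto simp: unitary_def)

lemma mat_powr_spec: "unitary P \<Longrightarrow> mat_powr (spec P l) p = spec P (\<lambda>i. l i powr p)"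
  unfolding spec_def by (rule mat_powr_eigendecomposition)

lemma real_diag_mult: "real_diag f ** real_diag g = real_diag (\<lambda>i. f i * g i)"
  by (simp add: vec_eq_iff real_diag_mult_left) (simp add: real_diag_def)

lemma adj_real_diag: "adj (real_diag f) = real_diag f"
  by (simp add: vec_eq_iff adj_def real_diag_def)

lemma adj_spec: "adj (spec P f) = spec P f"
  by (simp add: spec_def adj_mult adj_real_diag matrix_mul_assoc)

lemma hermitian_spec: "hermitian (spec P f)"
  by (simp add: hermitian_def adj_spec)

lemma spec_mult:
  assumes "unitary P"
  shows "spec P f ** spec P g = spec P (\<lambda>i. f i * g i)"
proof -
  have "spec P f ** spec P g = P ** real_diag f ** (adj P ** P) ** real_diag g ** adj P"
    by (simp add: spec_def matrix_mul_assoc)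
  also have "\<dots> = P ** (real_diag f ** real_diag g) ** adj P"
    by (simp add: unitaryD[OF assms] matrix_mul_assoc)
  finally show ?thesis by (simp add: real_diag_mult spec_def)
qed

lemma spec_scaleR: "c *\<^sub>R spec P f = spec P (\<lambda>i. c * f i)"
proof -
  have "real_diag (\<lambda>i. c * f i) = c *\<^sub>R real_diag f"
    by (simp add: vec_eq_iff real_diag_def) (simp add: scaleR_conv_of_real)
  then show ?thesis
    by (simp add: spec_def matrix_mult_scaleR_left matrix_mult_scaleR_right)
qed

lemma spec_one: "unitary P \<Longrightarrow> spec P (\<lambda>i. 1) = mat 1"
proof -
  have "real_diag (\<lambda>i :: 'a. 1) = mat 1"
    by (simp add: vec_eq_iff real_diag_def mat_def)
  then show "unitary P \<Longrightarrow> spec P (\<lambda>i. 1) = mat 1"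
    by (simp add: spec_def unitaryD)
qed

lemma real_diag_vec: "(real_diag f *v x) $ i = complex_of_real (f i) * x $ i"
proof -
  have "(real_diag f *v x) $ i = (\<Sum>j\<in>UNIV. if i = j then complex_of_real (f i) * x $ j else 0)"
    unfolding matrix_vector_mult_def real_diag_def vec_lambda_beta by (rule sum.cong) auto
  then show ?thesis by simp
qed

lemma norm_power2_vec: "(norm (x :: complex ^ 'n))\<^sup>2 = (\<Sum>i\<in>UNIV. (cmod (x $ i))\<^sup>2)"
  by (simp add: norm_vec_def L2_set_def sum_nonneg)

lemma quad_form_spec: "quad_form (spec P f) x = (\<Sum>i\<in>UNIV. f i * (cmod ((adj P *v x) $ i))\<^sup>2)"
proof -
  define y where "y = adj P *v x"
  have "quad_form (spec P f) x = x \<bullet> (P *v (real_diag f *v y))"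
    by (simp add: quad_form_inner spec_def matrix_vector_mul_assoc y_def matrix_mul_assoc)
  also have "\<dots> = y \<bullet> (real_diag f *v y)"
    by (simp add: inner_adj[of x P] y_def)
  also have "\<dots> = (\<Sum>i\<in>UNIV. f i * (cmod (y $ i))\<^sup>2)"
    by (simp add: inner_vec_def real_diag_vec inner_complex_def cmod_power2)
      (simp add: algebra_simps power2_eq_square)
  finally show ?thesis by (simp add: y_def)
qed

lemma unitary_norm: "unitary P \<Longrightarrow> norm (adj P *v x) = norm x"
proof -
  assume P: "unitary P"
  have "(adj P *v x) \<bullet> (adj P *v x) = x \<bullet> x"
    by (metis P inner_adj matrix_vector_mul_assoc matrix_vector_mul_lid unitaryD(2))
  then show ?thesis by (simp add: norm_eq)
qed

lemma unitary_sum_cmod: "unitary P \<Longrightarrow> (\<Sum>i\<in>UNIV. (cmod ((adj P *v x) $ i))\<^sup>2) = (norm x)\<^sup>2"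
  by (metis norm_power2_vec unitary_norm)

lemma unitary_axis:
  assumes "unitary P"
  shows "adj P *v (P *v axis i 1) = axis i 1" "P *v axis i 1 \<noteq> 0"
proof -
  show *: "adj P *v (P *v axis i 1) = axis i 1"
    by (simp add: matrix_vector_mul_assoc unitaryD[OF assms])
  show "P *v axis i 1 \<noteq> 0"
  proof
    assume "P *v axis i 1 = 0"
    with * have "axis i (1 :: complex) = 0" by simp
    then show False by (simp add: axis_eq_0_iff)
  qed
qed

text \<open>\<open>P *v axis i 1\<close> is the i-th eigenvector; testing on it isolates one
  eigenvalue, so definiteness can be read off from f.\<close>

lemma quad_form_spec_axis: "unitary P \<Longrightarrow> quad_form (spec P f) (P *v axis i 1) = f i"
  by (simp add: quad_form_spec unitary_axis) (simp add: axis_def if_distrib[of cmod]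
    if_distrib[of "\<lambda>x. x\<^sup>2"] if_distrib[of "\<lambda>x. _ * x"] cong: if_cong)

lemma psd_spec: "unitary P \<Longrightarrow> psd (spec P f) \<longleftrightarrow> (\<forall>i. 0 \<le> f i)"
  unfolding psd_def using quad_form_spec_axis[of P f]
  by (auto simp: hermitian_spec quad_form_spec intro!: sum_nonneg) metis

lemma posdef_spec:
  assumes P: "unitary P"
  shows "posdef (spec P f) \<longleftrightarrow> (\<forall>i. 0 < f i)"
proof
  assume "posdef (spec P f)"
  then show "\<forall>i. 0 < f i"
    unfolding posdef_def using quad_form_spec_axis[OF P, of f] unitary_axis(2)[OF P] by metis
next
  assume f: "\<forall>i. 0 < f i"
  have "0 < quad_form (spec P f) x" if "x \<noteq> 0" for x
  proof -
    have "(\<Sum>i\<in>UNIV. (cmod ((adj P *v x) $ i))\<^sup>2) \<noteq> 0"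
      using that by (simp add: unitary_sum_cmod[OF P])
    then obtain i where "(cmod ((adj P *v x) $ i))\<^sup>2 \<noteq> 0"
      by (meson sum.neutral)
    then show ?thesis
      unfolding quad_form_spec using f
      by (intro sum_pos2[of _ i]) (auto simp: less_imp_le)
  qed
  then show "posdef (spec P f)" by (simp add: posdef_def hermitian_spec)
qed

lemma psd_obtain_spec:
  assumes "psd A"
  obtains P l where "unitary P" "A = spec P l" "\<And>i. 0 \<le> l i"
proof -
  obtain P l where "unitary P" "A = spec P l"
    using hermitian_obtain_spec assms psd_def by metis
  then show thesis using that assms psd_spec by metis
qed

lemma posdef_obtain_spec:
  assumes "posdef A"
  obtains P l where "unitary P" "A = spec P l" "\<And>i. 0 < l i"
proof -
  obtain P l where "unitary P" "A = spec P l"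
    using hermitian_obtain_spec assms posdef_def by metis
  then show thesis using that assms posdef_spec by metis
qed

lemma posdef_imp_psd: "posdef A \<Longrightarrow> psd A"
  unfolding posdef_def psd_def quad_form_inner
  by (metis inner_zero_left less_imp_le order_refl)

lemma psd_mat_powr: "psd A \<Longrightarrow> psd (mat_powr A p)"
  by (erule psd_obtain_spec) (simp add: mat_powr_spec psd_spec)

lemma posdef_mat_powr: "posdef A \<Longrightarrow> posdef (mat_powr A p)"
proof (erule posdef_obtain_spec)
  fix P l assume "unitary P" "A = spec P l" "\<And>i. 0 < l i"
  then show ?thesis by (simp add: mat_powr_spec posdef_spec less_imp_neq[THEN not_sym])
qed

text \<open>Valid for singular A as well: 0 powr p = 0 for every p, so all powers live on the
  support of A.\<close>

lemma mat_powr_mat_powr: "psd A \<Longrightarrow> mat_powr (mat_powr A p) q = mat_powr A (p * q)"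
  by (erule psd_obtain_spec) (simp add: mat_powr_spec powr_powr)

lemma mat_powr_add: "posdef A \<Longrightarrow> mat_powr A p ** mat_powr A q = mat_powr A (p + q)"
  by (erule posdef_obtain_spec) (simp add: mat_powr_spec spec_mult powr_add)

lemma mat_powr_one: "psd A \<Longrightarrow> mat_powr A 1 = A"
  by (erule psd_obtain_spec) (simp add: mat_powr_spec)

lemma mat_powr_zero: "posdef A \<Longrightarrow> mat_powr A 0 = mat 1"
proof (erule posdef_obtain_spec)
  fix P l assume P: "unitary P" "A = spec P l" "\<And>i. 0 < l i"
  have "l i \<noteq> 0" for i using P(3)[of i] by simp
  with P show ?thesis by (simp add: mat_powr_spec spec_one)
qed

lemma mat_powr_scaleR: "psd A \<Longrightarrow> 0 \<le> c \<Longrightarrow> mat_powr (c *\<^sub>R A) p = (c powr p) *\<^sub>R mat_powr A p"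
  by (erule psd_obtain_spec) (simp add: mat_powr_spec spec_scaleR powr_mult)

lemma psd_iff: "psd A \<longleftrightarrow> adj A = A \<and> (\<forall>x. 0 \<le> x \<bullet> (A *v x))"
  by (simp add: psd_def hermitian_def quad_form_inner)

lemma posdef_iff: "posdef A \<longleftrightarrow> adj A = A \<and> (\<forall>x. x \<noteq> 0 \<longrightarrow> 0 < x \<bullet> (A *v x))"
  by (simp add: posdef_def hermitian_def quad_form_inner)

lemma psd_zero: "psd 0"
  by (simp add: psd_iff) (simp add: adj_def vec_eq_iff)

lemma psd_add: "psd A \<Longrightarrow> psd B \<Longrightarrow> psd (A + B)"
  by (simp add: psd_iff adj_add matrix_vector_mult_add_rdistrib inner_add_right)

lemma psd_scaleR: "psd A \<Longrightarrow> 0 \<le> c \<Longrightarrow> psd (c *\<^sub>R A)"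
  by (simp add: psd_iff adj_scaleR matrix_vector_mult_scaleR_left)

lemma posdef_scaleR: "posdef A \<Longrightarrow> 0 < c \<Longrightarrow> posdef (c *\<^sub>R A)"
  by (simp add: posdef_iff adj_scaleR matrix_vector_mult_scaleR_left)

lemma psd_sum: "(\<And>j. j \<in> J \<Longrightarrow> psd (f j)) \<Longrightarrow> psd (\<Sum>j\<in>J. f j)"
  by (induction J rule: infinite_finite_induct) (auto simp: psd_zero psd_add)

lemma loewner_le_iff:
  assumes "adj U = U" "adj V = V"
  shows "U \<preceq> V \<longleftrightarrow> (\<forall>x. x \<bullet> (U *v x) \<le> x \<bullet> (V *v x))"
  using assms by (simp add: loewner_le_def psd_iff adj_diff matrix_vector_mult_diff_rdistrib inner_diff_right)

lemma psd_adj: "psd A \<Longrightarrow> adj A = A"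
  by (simp add: psd_iff)

lemma posdef_adj: "posdef A \<Longrightarrow> adj A = A"
  by (simp add: posdef_iff)

lemma loewner_refl: "A \<preceq> A"
  by (simp add: loewner_le_def psd_zero)

lemma loewner_trans: "A \<preceq> B \<Longrightarrow> B \<preceq> C \<Longrightarrow> A \<preceq> C"
  unfolding loewner_le_def using psd_add[of "C - B" "B - A"] by simp

lemma loewner_scaleR: "A \<preceq> B \<Longrightarrow> 0 \<le> c \<Longrightarrow> c *\<^sub>R A \<preceq> c *\<^sub>R B"
  unfolding loewner_le_def using psd_scaleR[of "B - A" c] by (simp add: scaleR_diff_right)

lemma loewner_scaleR_mono: "psd A \<Longrightarrow> a \<le> b \<Longrightarrow> a *\<^sub>R A \<preceq> b *\<^sub>R A"
  unfolding loewner_le_def using psd_scaleR[of A "b - a"] by (simp add: scaleR_diff_left)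

lemma loewner_sum: "(\<And>j. j \<in> J \<Longrightarrow> f j \<preceq> g j) \<Longrightarrow> (\<Sum>j\<in>J. f j) \<preceq> (\<Sum>j\<in>J. g j)"
  unfolding loewner_le_def by (simp add: sum_subtractf[symmetric] psd_sum)

text \<open>In an eigenbasis the form is a sum of nonnegative terms l_i |y_i|^2, so y_i = 0 wherever
  l_i is nonzero. Every power has value 0 at the remaining eigenvalues, so it kills x too.\<close>

lemma psd_quad_zero:
  assumes "psd A" "x \<bullet> (A *v x) = 0"
  shows "A *v x = 0" "mat_powr A p *v x = 0"
proof -
  obtain P l where P: "unitary P" "A = spec P l" "\<And>i. 0 \<le> l i"
    using psd_obtain_spec[OF assms(1)] by blast
  define y where "y = adj P *v x"
  have "(\<Sum>i\<in>UNIV. l i * (cmod (y $ i))\<^sup>2) = 0"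
    using assms(2) by (simp add: y_def P(2) quad_form_spec[symmetric] quad_form_inner)
  then have ly: "l i = 0 \<or> y $ i = 0" for i
    using P(3) by (simp add: sum_nonneg_eq_0_iff)
  have *: "spec P f *v x = 0" if "\<And>i. f i = 0 \<or> y $ i = 0" for f
  proof -
    have "real_diag f *v y = 0"
      using that by (auto simp: vec_eq_iff real_diag_vec)
    then have "P *v (real_diag f *v y) = 0" by simp
    then show ?thesis by (simp add: spec_def y_def matrix_vector_mul_assoc matrix_mul_assoc)
  qed
  show "A *v x = 0" unfolding P(2) using ly by (rule *)
  show "mat_powr A p *v x = 0"
    unfolding P(2) mat_powr_spec[OF P(1)] using ly by (intro *) auto
qed

lemma mat_powr_kernel:
  assumes "psd A" "p \<noteq> 0" "mat_powr A p *v x = 0"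
  shows "A *v x = 0"
proof -
  have "x \<bullet> (mat_powr A p *v x) = 0" using assms by simp
  from psd_quad_zero(2)[OF psd_mat_powr[OF assms(1)] this, of "1 / p"]
  show ?thesis using assms by (simp add: mat_powr_mat_powr mat_powr_one)
qed

lemma loewner_antisym:
  assumes "A \<preceq> B" "B \<preceq> A"
  shows "A = B"
proof -
  have "(B - A) *v x = 0" for x
  proof -
    have "x \<bullet> ((B - A) *v x) = 0"
      using assms unfolding loewner_le_def psd_iff
      by (simp add: matrix_vector_mult_diff_rdistrib inner_diff_right) (smt (verit))
    then show ?thesis using assms(1) psd_quad_zero(1) by (simp add: loewner_le_def)
  qed
  then show ?thesis
    by (metis eq_iff_diff_eq_0 matrix_eq matrix_vector_mult_0)
qed

section \<open>Traces of products in two eigenbases\<close>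

text \<open>Squared moduli of the change-of-basis matrix between two eigenbases; for unitary P and V
  this matrix is doubly stochastic.\<close>

definition overlap :: "complex ^ 'n::finite ^ 'n \<Rightarrow> complex ^ 'n ^ 'n \<Rightarrow> 'n \<Rightarrow> 'n \<Rightarrow> real" where
  "overlap P V i j = (cmod ((adj P ** V) $ i $ j))\<^sup>2"

lemma overlap_nonneg: "0 \<le> overlap P V i j"
  by (simp add: overlap_def)

text \<open>The factors need not commute, yet their trace is a sum over pairs of eigenvalues with
  nonnegative weights, so scalar inequalities can be applied term by term.\<close>

lemma Re_trace_spec_mult:
  "Re (trace (spec P f ** spec V g)) = (\<Sum>i\<in>UNIV. \<Sum>j\<in>UNIV. f i * g j * overlap P V i j)"
proof -
  define W where "W = adj P ** V"
  have adjW: "adj V ** P = adj W" by (simp add: W_def adj_mult)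
  have "trace (spec P f ** spec V g) = trace (P ** (real_diag f ** (adj P ** V) ** real_diag g ** adj V))"
    by (simp add: spec_def matrix_mul_assoc)
  also have "\<dots> = trace ((real_diag f ** (adj P ** V) ** real_diag g ** adj V) ** P)"
    by (rule trace_mul_sym)
  also have "\<dots> = trace ((real_diag f ** W ** real_diag g) ** adj W)"
    by (simp add: W_def[symmetric] adjW[symmetric] matrix_mul_assoc)
  also have "\<dots> = (\<Sum>i\<in>UNIV. \<Sum>j\<in>UNIV. complex_of_real (f i * g j) * (W $ i $ j * cnj (W $ i $ j)))"
    unfolding trace_def
    by (rule sum.cong[OF refl], subst matrix_matrix_mult_def)
       (simp add: real_diag_mult_left real_diag_mult_right adj_def mult_ac)
  also have "\<dots> = complex_of_real (\<Sum>i\<in>UNIV. \<Sum>j\<in>UNIV. f i * g j * overlap P V i j)"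
    by (simp add: overlap_def W_def complex_mult_cnj cmod_power2)
  finally show ?thesis by simp
qed

lemma overlap_sum_right:
  assumes "unitary P" "unitary V"
  shows "(\<Sum>j\<in>UNIV. overlap P V i j) = 1"
proof -
  define W where "W = adj P ** V"
  have "W ** adj W = adj P ** (V ** adj V) ** P"
    by (simp add: W_def adj_mult matrix_mul_assoc)
  then have "W ** adj W = mat 1" by (simp add: unitaryD assms)
  then have "(\<Sum>j\<in>UNIV. W $ i $ j * cnj (W $ i $ j)) = 1"
    by (simp add: vec_eq_iff matrix_matrix_mult_def adj_def mat_def)
  then have "complex_of_real (\<Sum>j\<in>UNIV. overlap P V i j) = 1"
    by (simp add: overlap_def W_def complex_mult_cnj cmod_power2)
  then show ?thesis using of_real_eq_1_iff by blast
qed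

lemma overlap_sym: "overlap P V i j = overlap V P j i"
proof -
  have "adj V ** P = adj (adj P ** V)" by (simp add: adj_mult)
  then show ?thesis by (simp add: overlap_def) (simp add: adj_def)
qed

lemma overlap_sum_left:
  assumes "unitary P" "unitary V"
  shows "(\<Sum>i\<in>UNIV. overlap P V i j) = 1"
  using overlap_sum_right[OF assms(2,1), of j] by (simp add: overlap_sym[of P V])

lemma overlap_sum_row:
  assumes "unitary P" "unitary V"
  shows "(\<Sum>i\<in>UNIV. \<Sum>j\<in>UNIV. f i * overlap P V i j) = (\<Sum>i\<in>UNIV. f i)"
  by (simp add: sum_distrib_left[symmetric] overlap_sum_right[OF assms])

lemma overlap_sum_col:
  assumes "unitary P" "unitary V"
  shows "(\<Sum>i\<in>UNIV. \<Sum>j\<in>UNIV. g j * overlap P V i j) = (\<Sum>j\<in>UNIV. g j)"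
  by (subst sum.swap) (simp add: sum_distrib_left[symmetric] overlap_sum_left[OF assms])

text \<open>Serves the equality cases of the trace inequalities. The change-of-basis matrix W
  vanishes wherever f_i and g_j differ, hence intertwines the two diagonal matrices.\<close>

lemma spec_eq_if_overlap:
  assumes "unitary P" "unitary V" and eq: "\<And>i j. overlap P V i j = 0 \<or> f i = g j"
  shows "spec P f = spec V g"
proof -
  define W where "W = adj P ** V"
  have "complex_of_real (f i) * W $ i $ j = W $ i $ j * complex_of_real (g j)" for i j
    using eq[of i j] by (auto simp: overlap_def W_def)
  then have *: "real_diag f ** W = W ** real_diag g"
    by (simp add: vec_eq_iff real_diag_mult_left real_diag_mult_right)
  have "spec P f = P ** (real_diag f ** (adj P ** (V ** adj V)))"
    by (simp add: unitaryD assms spec_def matrix_mul_assoc)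
  also have "\<dots> = P ** (real_diag f ** W) ** adj V"
    by (simp add: W_def matrix_mul_assoc)
  also have "\<dots> = (P ** adj P) ** V ** real_diag g ** adj V"
    unfolding * by (simp add: W_def matrix_mul_assoc)
  also have "\<dots> = spec V g"
    by (simp add: unitaryD assms spec_def)
  finally show ?thesis .
qed

lemma Re_trace_spec: "unitary P \<Longrightarrow> Re (trace (spec P f)) = (\<Sum>i\<in>UNIV. f i)"
  using Re_trace_spec_mult[of P f P "\<lambda>i. 1"] overlap_sum_row[of P P f]
  by (simp add: spec_one)

lemma trace_scaleR: "trace (c *\<^sub>R (A :: complex ^ 'n ^ 'n)) = c *\<^sub>R trace A"
  by (simp add: trace_def scaleR_sum_right)

lemma psd_trace_mult_nonneg:
  assumes "psd A" "psd B"
  shows "0 \<le> Re (trace (A ** B))"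
proof -
  obtain P f where P: "unitary P" "A = spec P f" "\<And>i. 0 \<le> f i" using psd_obtain_spec[OF assms(1)] by blast
  obtain V g where V: "unitary V" "B = spec V g" "\<And>i. 0 \<le> g i" using psd_obtain_spec[OF assms(2)] by blast
  show ?thesis
    unfolding P(2) V(2) Re_trace_spec_mult using P(3) V(3) by (intro sum_nonneg mult_nonneg_nonneg overlap_nonneg)
qed

text \<open>A has some eigenvalue f_i > 0; the i-th row of overlaps sums to 1, so f_i is paired with
  some g_j > 0 with positive weight.\<close>

lemma psd_trace_mult_pos:
  assumes "psd A" "A \<noteq> 0" "posdef B"
  shows "0 < Re (trace (A ** B))"
proof -
  obtain P f where P: "unitary P" "A = spec P f" "\<And>i. 0 \<le> f i" using psd_obtain_spec[OF assms(1)] by blast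
  obtain V g where V: "unitary V" "B = spec V g" "\<And>i. 0 < g i" using posdef_obtain_spec[OF assms(3)] by blast
  have "spec P (\<lambda>i. 0) = 0" using spec_scaleR[of 0 P f] by simp
  then have "f \<noteq> (\<lambda>i. 0)" using assms(2) P(2) by metis
  then obtain i where "f i \<noteq> 0" by blast
  then have i: "0 < f i" using P(3)[of i] by simp
  have "(\<Sum>j\<in>UNIV. overlap P V i j) \<noteq> 0" by (simp add: overlap_sum_right P V)
  then obtain j where "overlap P V i j \<noteq> 0" by (meson sum.neutral)
  then have j: "0 < overlap P V i j" using overlap_nonneg[of P V i j] by simp
  have nn: "0 \<le> f i * g j * overlap P V i j" for i j
    by (intro mult_nonneg_nonneg overlap_nonneg P(3) less_imp_le[OF V(3)])
  show ?thesis
    unfolding P(2) V(2) Re_trace_spec_mult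
    by (rule sum_pos2[of _ i], simp, simp, rule sum_pos2[of _ j]) (auto simp: i j V(3) nn sum_nonneg simp del: mult_nonneg_nonneg)
qed

lemma trace_mult_diff_right: "trace (A ** (B - C)) = trace (A ** B) - trace ((A ** C) :: complex ^ 'n ^ 'n)"
  by (simp add: trace_def matrix_matrix_mult_def sum_subtractf[symmetric] algebra_simps)

lemma loewner_trace_mult:
  assumes "psd A" "U \<preceq> V"
  shows "Re (trace (A ** U)) \<le> Re (trace (A ** V))"
  using psd_trace_mult_nonneg[of A "V - U"] assms by (simp add: loewner_le_def trace_mult_diff_right)

section \<open>Loewner-Heinz inequality\<close>

lemma mat_powr_half_norm:
  assumes "posdef U"
  shows "x \<bullet> (mat_powr U a *v x) = (norm (mat_powr U (a / 2) *v x))\<^sup>2"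
proof -
  have "x \<bullet> (mat_powr U a *v x) = x \<bullet> (mat_powr U (a / 2) *v (mat_powr U (a / 2) *v x))"
    by (simp add: matrix_vector_mul_assoc mat_powr_add[OF assms])
  also have "\<dots> = (mat_powr U (a / 2) *v x) \<bullet> (mat_powr U (a / 2) *v x)"
    by (simp add: inner_adj posdef_adj posdef_mat_powr assms)
  finally show ?thesis by (simp add: dot_square_norm)
qed

lemma loewner_posdef_iff:
  "posdef U \<Longrightarrow> posdef V \<Longrightarrow> U \<preceq> V \<longleftrightarrow> (\<forall>x. x \<bullet> (U *v x) \<le> x \<bullet> (V *v x))"
  by (simp add: loewner_le_iff posdef_adj)

text \<open>If U^c x = m V^c x with c = (a+b)/2, then for y = V^((b-a)/2) x
  m |V^(b/2) x|^2 = m (y, V^c x) = (U^(a/2) y, U^(b/2) x), which by Cauchy-Schwarz is at most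
  |V^(a/2) y| |V^(b/2) x| = |V^(b/2) x|^2; so all generalised eigenvalues m are at most 1.\<close>

lemma loewner_mat_powr_midpoint:
  assumes U: "posdef U" and V: "posdef V"
    and a: "mat_powr U a \<preceq> mat_powr V a" and b: "mat_powr U b \<preceq> mat_powr V b"
  shows "mat_powr U ((a + b) / 2) \<preceq> mat_powr V ((a + b) / 2)"
proof -
  define c where "c = (a + b) / 2"
  note pU = posdef_mat_powr[OF U] and pV = posdef_mat_powr[OF V]
  have le: "norm (mat_powr U (d / 2) *v x) \<le> norm (mat_powr V (d / 2) *v x)"
    if "mat_powr U d \<preceq> mat_powr V d" for d x
  proof -
    have "(norm (mat_powr U (d / 2) *v x))\<^sup>2 \<le> (norm (mat_powr V (d / 2) *v x))\<^sup>2"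
      using that by (simp add: loewner_posdef_iff pU pV mat_powr_half_norm U V)
    then show ?thesis by simp
  qed
  define R where "R = mat_powr V (c / 2)"
  define R' where "R' = mat_powr V (- (c / 2))"
  \<comment> \<open>The generalised eigenvalues of the pair U^c, V^c are the ordinary eigenvalues of
    this Hermitian matrix.\<close>
  define M where "M = R' ** mat_powr U c ** R'"
  have RR': "R ** R' = mat 1" "R' ** R = mat 1"
    by (simp_all add: R_def R'_def mat_powr_add[OF V] mat_powr_zero[OF V])
  have RR: "R ** R = mat_powr V c" by (simp add: R_def mat_powr_add[OF V])
  have adjR: "adj R = R" "adj R' = R'" by (simp_all add: R_def R'_def posdef_adj pV)
  have RMR: "R ** M ** R = mat_powr U c"
  proof -
    have "R ** M ** R = (R ** R') ** mat_powr U c ** (R' ** R)"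
      by (simp only: M_def matrix_mul_assoc)
    then show ?thesis by (simp add: RR')
  qed
  have "hermitian M"
    by (simp add: hermitian_def M_def adj_mult adjR posdef_adj[OF pU] matrix_mul_assoc)
  then obtain W m where W: "unitary W" and M: "M = spec W m"
    using hermitian_obtain_spec by blast
  have m: "m i \<le> 1" for i
  proof -
    define v where "v = W *v axis i 1"
    define x where "x = R' *v v"
    define y where "y = mat_powr V ((b - a) / 2) *v x"
    have "adj W *v v = axis i 1" "v \<noteq> 0" using unitary_axis[OF W, of i] by (auto simp: v_def)
    have "real_diag m *v axis i 1 = m i *\<^sub>R axis i (1::complex)"
      by (simp add: vec_eq_iff real_diag_vec axis_def) (simp add: scaleR_conv_of_real)
    then have "M *v v = m i *\<^sub>R v"
      using \<open>adj W *v v = axis i 1\<close>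
      by (simp add: M spec_def matrix_vector_mul_assoc[symmetric] matrix_vector_mult_scaleR_right v_def)
    moreover have Rx: "R *v x = v" by (simp add: x_def matrix_vector_mul_assoc RR')
    moreover have "mat_powr U c *v x = R *v (M *v (R *v x))"
      by (simp add: RMR[symmetric] matrix_vector_mul_assoc matrix_mul_assoc)
    ultimately have eig: "mat_powr U c *v x = m i *\<^sub>R (mat_powr V c *v x)"
      by (simp add: matrix_vector_mult_scaleR_right RR[symmetric] matrix_vector_mul_assoc[symmetric])
    have "x \<noteq> 0" using Rx \<open>v \<noteq> 0\<close> by auto
    have "mat_powr V (- (b / 2)) *v (mat_powr V (b / 2) *v x) = x"
      by (simp add: matrix_vector_mul_assoc mat_powr_add[OF V] mat_powr_zero[OF V])
    then have "mat_powr V (b / 2) *v x \<noteq> 0" using \<open>x \<noteq> 0\<close> by auto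
    then have pos: "0 < (norm (mat_powr V (b / 2) *v x))\<^sup>2" by simp
    have "m i * (norm (mat_powr V (b / 2) *v x))\<^sup>2 = m i * (x \<bullet> (mat_powr V b *v x))"
      by (simp add: mat_powr_half_norm V)
    also have "mat_powr V b *v x = mat_powr V ((b - a) / 2) *v (mat_powr V c *v x)"
      by (simp add: matrix_vector_mul_assoc mat_powr_add[OF V] c_def field_simps)
    also have "x \<bullet> \<dots> = y \<bullet> (mat_powr V c *v x)"
      by (simp add: inner_adj[of x] posdef_adj pV y_def)
    also have "m i * (y \<bullet> (mat_powr V c *v x)) = y \<bullet> (mat_powr U c *v x)"
      by (simp add: eig)
    also have "mat_powr U c *v x = mat_powr U (a / 2) *v (mat_powr U (b / 2) *v x)"
      by (simp add: matrix_vector_mul_assoc mat_powr_add[OF U] c_def add_divide_distrib)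
    also have "y \<bullet> \<dots> = (mat_powr U (a / 2) *v y) \<bullet> (mat_powr U (b / 2) *v x)"
      by (simp add: inner_adj[of y] posdef_adj pU)
    also have "\<dots> \<le> norm (mat_powr U (a / 2) *v y) * norm (mat_powr U (b / 2) *v x)"
      by (rule norm_cauchy_schwarz)
    also have "\<dots> \<le> norm (mat_powr V (a / 2) *v y) * norm (mat_powr V (b / 2) *v x)"
      by (intro mult_mono le a b) auto
    also have "mat_powr V (a / 2) *v y = mat_powr V (b / 2) *v x"
      by (simp add: y_def matrix_vector_mul_assoc mat_powr_add[OF V] diff_divide_distrib)
    finally show ?thesis using pos by (simp add: power2_eq_square[symmetric])
  qed
  have "x \<bullet> (mat_powr U c *v x) \<le> x \<bullet> (mat_powr V c *v x)" for x
  proof -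
    have "x \<bullet> (mat_powr U c *v x) = quad_form M (R *v x)"
      by (simp add: quad_form_inner RMR[symmetric] matrix_vector_mul_assoc[symmetric] inner_adj[of x] adjR)
    also have "\<dots> \<le> (\<Sum>i\<in>UNIV. 1 * (cmod ((adj W *v (R *v x)) $ i))\<^sup>2)"
      unfolding M quad_form_spec by (intro sum_mono mult_right_mono m) auto
    also have "\<dots> = (R *v x) \<bullet> (R *v x)"
      by (simp add: unitary_sum_cmod[OF W] dot_square_norm)
    also have "\<dots> = x \<bullet> (mat_powr V c *v x)"
      by (simp add: RR[symmetric] matrix_vector_mul_assoc[symmetric] inner_adj[of x] adjR)
    finally show ?thesis .
  qed
  then show ?thesis by (simp add: loewner_posdef_iff pU pV c_def)
qed

lemma continuous_on_inner_mat_powr: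
  assumes "posdef U"
  shows "continuous_on S (\<lambda>p. x \<bullet> (mat_powr U p *v x))"
proof -
  obtain P l where P: "unitary P" "U = spec P l" "\<And>i. 0 < l i"
    using posdef_obtain_spec[OF assms] by blast
  have "l i \<noteq> 0" for i using P(3)[of i] by simp
  then show ?thesis
    unfolding P(2) mat_powr_spec[OF P(1)] quad_form_inner[symmetric] quad_form_spec
    by (intro continuous_intros) auto
qed

text \<open>If p were missing, compactness would give nearest points a < p < b of S on the two
  sides; their midpoint lies in S strictly between them, contradicting the choice of one of
  them.\<close>

lemma closed_midpoint_interval:
  fixes S :: "real set"
  assumes "closed S" and mid: "\<And>a b. a \<in> S \<Longrightarrow> b \<in> S \<Longrightarrow> (a + b) / 2 \<in> S"
    and "u \<in> S" "v \<in> S" "u \<le> p" "p \<le> v"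
  shows "p \<in> S"
proof (rule ccontr)
  assume "p \<notin> S"
  have "compact (S \<inter> {u..p})" "compact (S \<inter> {p..v})"
    using \<open>closed S\<close> by (auto intro: closed_Int_compact)
  moreover have "S \<inter> {u..p} \<noteq> {}" "S \<inter> {p..v} \<noteq> {}"
    using assms(3-6) by auto
  ultimately obtain a b where a: "a \<in> S \<inter> {u..p}" "\<And>x. x \<in> S \<inter> {u..p} \<Longrightarrow> x \<le> a"
    and b: "b \<in> S \<inter> {p..v}" "\<And>x. x \<in> S \<inter> {p..v} \<Longrightarrow> b \<le> x"
    using compact_attains_sup compact_attains_inf by meson
  have "a < p" "p < b" using a(1) b(1) \<open>p \<notin> S\<close> by (auto simp: less_le)
  have m: "(a + b) / 2 \<in> S" using mid a b by blast
  show False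
  proof (cases "(a + b) / 2 \<le> p")
    case True
    with m a b have "(a + b) / 2 \<le> a" by (intro a(2)) auto
    then show False using \<open>a < p\<close> \<open>p < b\<close> by simp
  next
    case False
    with m a b have "b \<le> (a + b) / 2" by (intro b(2)) auto
    then show False using \<open>a < p\<close> \<open>p < b\<close> by simp
  qed
qed

text \<open>For the given pair, the exponents preserving the order form a set that is closed by
  continuity, stable under midpoints, and contains 0 and 1.\<close>

theorem loewner_heinz:
  assumes U: "posdef U" and V: "posdef V" and le: "U \<preceq> V" and p: "0 \<le> p" "p \<le> 1"
  shows "mat_powr U p \<preceq> mat_powr V p"
proof -
  define S where "S = {p. mat_powr U p \<preceq> mat_powr V p}"
  have "S = {p. \<forall>x. x \<bullet> (mat_powr U p *v x) \<le> x \<bullet> (mat_powr V p *v x)}"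
    by (simp add: S_def loewner_posdef_iff posdef_mat_powr U V)
  then have "closed S"
    by (simp add: closed_Collect_all closed_Collect_le continuous_on_inner_mat_powr U V)
  moreover have "(a + b) / 2 \<in> S" if "a \<in> S" "b \<in> S" for a b
    using that by (simp add: S_def loewner_mat_powr_midpoint[OF U V])
  moreover have "0 \<in> S" "1 \<in> S"
    using le by (simp_all add: S_def mat_powr_zero U V loewner_refl mat_powr_one posdef_imp_psd)
  ultimately have "p \<in> S"
    using p by (rule closed_midpoint_interval)
  then show ?thesis by (simp add: S_def)
qed

text \<open>Completing the square: for y = V^(-1) x and z = U^(-1) x, nonnegativity of the form of U
  at y - z gives 2 (x, y) \<le> (y, U y) + (x, z), and (y, U y) \<le> (y, V y) = (x, y).\<close>

lemma loewner_inverse_antimono: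
  assumes U: "posdef U" and V: "posdef V" and le: "U \<preceq> V"
  shows "mat_powr V (- 1) \<preceq> mat_powr U (- 1)"
proof -
  have "x \<bullet> (mat_powr V (- 1) *v x) \<le> x \<bullet> (mat_powr U (- 1) *v x)" for x
  proof -
    define y where "y = mat_powr V (- 1) *v x"
    define z where "z = mat_powr U (- 1) *v x"
    have inv: "W *v (mat_powr W (- 1) *v x) = x" if "posdef W" for W
      using mat_powr_add[OF that, of 1 "- 1"]
      by (simp add: matrix_vector_mul_assoc mat_powr_one posdef_imp_psd that mat_powr_zero)
    have Vy: "V *v y = x" and Uz: "U *v z = x" by (simp_all add: y_def z_def inv U V)
    have zUy: "z \<bullet> (U *v y) = x \<bullet> y" by (simp add: inner_adj[of z] posdef_adj U Uz)
    have "0 \<le> (y - z) \<bullet> (U *v (y - z))"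
      using posdef_imp_psd[OF U] by (simp add: psd_iff)
    also have "\<dots> = y \<bullet> (U *v y) - 2 * (x \<bullet> y) + x \<bullet> z"
      by (simp add: matrix_vector_mult_diff_distrib inner_diff_left inner_diff_right zUy Uz inner_commute)
    also have "y \<bullet> (U *v y) \<le> y \<bullet> (V *v y)" using le by (simp add: loewner_posdef_iff U V)
    finally show ?thesis by (simp add: Vy y_def[symmetric] z_def[symmetric] inner_commute)
  qed
  then show ?thesis by (simp add: loewner_posdef_iff posdef_mat_powr U V)
qed

lemma loewner_heinz_neg:
  assumes U: "posdef U" and V: "posdef V" and le: "U \<preceq> V" and p: "0 \<le> p" "p \<le> 1"
  shows "mat_powr V (- p) \<preceq> mat_powr U (- p)"
  using loewner_inverse_antimono[OF posdef_mat_powr[OF U] posdef_mat_powr[OF V] loewner_heinz[OF assms]]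
  by (simp add: mat_powr_mat_powr posdef_imp_psd U V)

section \<open>Trace inequalities\<close>

lemma young_le:
  fixes x q p :: real
  assumes p: "0 < p" "p < 1" and x: "0 < x" and q: "0 \<le> q"
  shows "x powr p * q powr (1 - p) \<le> p * x + (1 - p) * q"
    and "x powr p * q powr (1 - p) = p * x + (1 - p) * q \<Longrightarrow> x = q"
proof -
  define g where "g = x powr p * q powr (1 - p)"
  define m where "m = p * x + (1 - p) * q"
  have m: "0 < m" unfolding m_def using assms by (intro add_pos_nonneg mult_pos_pos mult_nonneg_nonneg) auto
  have strict: "g < m" if "x \<noteq> q"
  proof (cases "q = 0")
    case True
    then show ?thesis using m by (simp add: g_def)
  next
    case False
    then have q: "0 < q" using q by simp
    have "x / m \<noteq> 1"
    proof
      assume "x / m = 1"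
      then have "x = m" using m by simp
      then have "(1 - p) * (x - q) = 0" by (simp add: m_def algebra_simps)
      then show False using that p by simp
    qed
    moreover have "0 < x / m" "0 < q / m" using x q m by auto
    ultimately have "ln (x / m) < x / m - 1" "ln (q / m) \<le> q / m - 1"
      using ln_le_minus_one ln_eq_minus_one by (metis less_le)+
    then have "p * ln (x / m) + (1 - p) * ln (q / m) < p * (x / m - 1) + (1 - p) * (q / m - 1)"
      using p by (intro add_less_le_mono mult_strict_left_mono mult_left_mono) auto
    also have "\<dots> = (p * x + (1 - p) * q) / m - 1"
      by (simp add: field_simps add_divide_distrib diff_divide_distrib)
    also have "\<dots> = 0" using m by (simp add: m_def)
    also have "p * ln (x / m) + (1 - p) * ln (q / m) = ln (g / m)"
      using x q m by (simp add: g_def ln_div ln_mult ln_powr algebra_simps)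
    finally show ?thesis using x q m by (simp add: g_def ln_div)
  qed
  have eq: "g = m" if "x = q"
    using that x by (simp add: g_def m_def powr_add[symmetric] algebra_simps)
  show "x powr p * q powr (1 - p) \<le> p * x + (1 - p) * q"
    using strict eq by (fold g_def m_def) force
  show "x powr p * q powr (1 - p) = p * x + (1 - p) * q \<Longrightarrow> x = q"
    using strict by (fold g_def m_def) force
qed

text \<open>For x > 0 this is \<open>young_le\<close> with exponent 1/p for g = x^p q^(1-p) and q:
  their weighted geometric mean is x, and the inequality is solved for g.\<close>

lemma young_ge:
  fixes x q p :: real
  assumes p: "1 < p" and x: "0 \<le> x" and q: "0 < q"
  shows "p * x + (1 - p) * q \<le> x powr p * q powr (1 - p)"
    and "x powr p * q powr (1 - p) = p * x + (1 - p) * q \<Longrightarrow> x = q"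
proof -
  define g where "g = x powr p * q powr (1 - p)"
  have "p * x + (1 - p) * q \<le> g \<and> (g = p * x + (1 - p) * q \<longrightarrow> x = q)"
  proof (cases "x = 0")
    case True
    then show ?thesis using mult_pos_pos[of "p - 1" q] p q by (simp add: g_def algebra_simps)
  next
    case False
    then have "0 < x" using x by simp
    then have g: "0 < g" using q by (simp add: g_def)
    have "g powr (1 / p) * q powr (1 - 1 / p) = x * (q powr ((1 - p) / p) * q powr (1 - 1 / p))"
      using p \<open>0 < x\<close> q by (simp add: g_def powr_mult powr_powr)
    also have "\<dots> = x"
      using p q by (simp add: powr_add[symmetric] diff_divide_distrib)
    finally have *: "g powr (1 / p) * q powr (1 - 1 / p) = x" .
    have 1: "x \<le> 1 / p * g + (1 - 1 / p) * q" and 2: "x = 1 / p * g + (1 - 1 / p) * q \<Longrightarrow> g = q"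
      using young_le[of "1 / p" g q] p g q by (simp_all add: *)
    have e: "1 / p * g + (1 - 1 / p) * q = (g + (p - 1) * q) / p"
      using p by (simp add: field_simps)
    have "x = q" if "g = p * x + (1 - p) * q"
    proof -
      have "x = (g + (p - 1) * q) / p" using that p by (simp add: field_simps)
      then have "g = q" using 2 e by simp
      then have "p * (x - q) = 0" using that by (simp add: algebra_simps)
      then show ?thesis using p by simp
    qed
    moreover have "p * x + (1 - p) * q \<le> g"
      using 1 p unfolding e by (simp add: field_simps)
    ultimately show ?thesis by blast
  qed
  then show "p * x + (1 - p) * q \<le> x powr p * q powr (1 - p)"
    and "x powr p * q powr (1 - p) = p * x + (1 - p) * q \<Longrightarrow> x = q"
    by (auto simp: g_def)
qed

text \<open>The tangent at x to the convex function t^s. It is Young's inequality multiplied by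
  x^(s-1), with exponent s if s > 1 and exponent 1 - s with x and y exchanged if s < 0.\<close>

lemma powr_tangent:
  fixes x y s :: real
  assumes s: "s < 0 \<or> 1 < s" and x: "0 < x" and y: "0 < y"
  shows "s * (y * x powr (s - 1)) + (1 - s) * x powr s \<le> y powr s"
proof -
  have "s * y + (1 - s) * x \<le> y powr s * x powr (1 - s)"
    using s young_ge(1)[of s y x] young_ge(1)[of "1 - s" x y] x y
    by (auto simp: mult.commute add.commute)
  then have "(s * y + (1 - s) * x) * x powr (s - 1) \<le> (y powr s * x powr (1 - s)) * x powr (s - 1)"
    by (intro mult_right_mono) auto
  also have "\<dots> = y powr s" using x by (simp add: mult.assoc powr_add[symmetric])
  finally show ?thesis
    using x powr_mult_base[of x "s - 1"] by (simp add: algebra_simps)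
qed

lemma overlap_sum_affine:
  assumes "unitary P" "unitary V"
  shows "(\<Sum>i\<in>UNIV. \<Sum>j\<in>UNIV. (c * f i + d * g j) * overlap P V i j)
    = c * (\<Sum>i\<in>UNIV. f i) + d * (\<Sum>j\<in>UNIV. g j)"
proof -
  have "(\<Sum>i\<in>UNIV. \<Sum>j\<in>UNIV. (c * f i + d * g j) * overlap P V i j)
      = c * (\<Sum>i\<in>UNIV. \<Sum>j\<in>UNIV. f i * overlap P V i j) + d * (\<Sum>i\<in>UNIV. \<Sum>j\<in>UNIV. g j * overlap P V i j)"
    by (simp add: sum_distrib_left sum.distrib distrib_right mult.assoc)
  then show ?thesis by (simp add: overlap_sum_row[OF assms] overlap_sum_col[OF assms])
qed

text \<open>Scalar Young inequality averaged over the overlaps, whose row and column sums of 1 turn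
  the affine side into the two traces. Equality kills every term, so eigenvalues with nonzero
  overlap agree.\<close>

lemma trace_young_le:
  assumes p: "0 < p" "p < 1" and X: "posdef X" and Q: "psd Q"
  shows "Re (trace (mat_powr X p ** mat_powr Q (1 - p))) \<le> p * Re (trace X) + (1 - p) * Re (trace Q)"
    and "Re (trace (mat_powr X p ** mat_powr Q (1 - p))) = p * Re (trace X) + (1 - p) * Re (trace Q) \<Longrightarrow> X = Q"
proof -
  obtain P x where P: "unitary P" "X = spec P x" "\<And>i. 0 < x i" using posdef_obtain_spec[OF X] by blast
  obtain V q where V: "unitary V" "Q = spec V q" "\<And>i. 0 \<le> q i" using psd_obtain_spec[OF Q] by blast
  define g where "g i j = p * x i + (1 - p) * q j - x i powr p * q j powr (1 - p)" for i j
  have g: "0 \<le> g i j" "g i j = 0 \<Longrightarrow> x i = q j" for i j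
    using young_le[OF p P(3) V(3), of i j] by (auto simp: g_def)
  have eq: "p * Re (trace X) + (1 - p) * Re (trace Q) - Re (trace (mat_powr X p ** mat_powr Q (1 - p)))
      = (\<Sum>i\<in>UNIV. \<Sum>j\<in>UNIV. g i j * overlap P V i j)"
    by (simp only: P(2) V(2) mat_powr_spec[OF P(1)] mat_powr_spec[OF V(1)] Re_trace_spec_mult
        Re_trace_spec[OF P(1)] Re_trace_spec[OF V(1)] overlap_sum_affine[OF P(1) V(1), symmetric]
        g_def left_diff_distrib[of _ _ "overlap P V _ _"] sum_subtractf)
  have nn: "0 \<le> g i j * overlap P V i j" for i j
    by (intro mult_nonneg_nonneg g(1) overlap_nonneg)
  then have "0 \<le> (\<Sum>i\<in>UNIV. \<Sum>j\<in>UNIV. g i j * overlap P V i j)" by (intro sum_nonneg)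
  with eq show "Re (trace (mat_powr X p ** mat_powr Q (1 - p))) \<le> p * Re (trace X) + (1 - p) * Re (trace Q)"
    by simp
  assume "Re (trace (mat_powr X p ** mat_powr Q (1 - p))) = p * Re (trace X) + (1 - p) * Re (trace Q)"
  with eq have "\<forall>i. \<forall>j. g i j * overlap P V i j = 0"
    using nn by (simp add: sum_nonneg_eq_0_iff sum_nonneg del: mult_eq_0_iff)
  then show "X = Q" unfolding P(2) V(2) using g(2)
    by (intro spec_eq_if_overlap P(1) V(1)) auto
qed

lemma trace_young_ge:
  assumes p: "1 < p" and X: "psd X" and Q: "posdef Q"
  shows "p * Re (trace X) + (1 - p) * Re (trace Q) \<le> Re (trace (mat_powr X p ** mat_powr Q (1 - p)))"
    and "Re (trace (mat_powr X p ** mat_powr Q (1 - p))) = p * Re (trace X) + (1 - p) * Re (trace Q) \<Longrightarrow> X = Q"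
proof -
  obtain P x where P: "unitary P" "X = spec P x" "\<And>i. 0 \<le> x i" using psd_obtain_spec[OF X] by blast
  obtain V q where V: "unitary V" "Q = spec V q" "\<And>i. 0 < q i" using posdef_obtain_spec[OF Q] by blast
  define g where "g i j = x i powr p * q j powr (1 - p) - (p * x i + (1 - p) * q j)" for i j
  have g: "0 \<le> g i j" "g i j = 0 \<Longrightarrow> x i = q j" for i j
    using young_ge[OF p P(3) V(3), of i j] by (auto simp: g_def)
  have eq: "Re (trace (mat_powr X p ** mat_powr Q (1 - p))) - (p * Re (trace X) + (1 - p) * Re (trace Q))
      = (\<Sum>i\<in>UNIV. \<Sum>j\<in>UNIV. g i j * overlap P V i j)"
    by (simp only: P(2) V(2) mat_powr_spec[OF P(1)] mat_powr_spec[OF V(1)] Re_trace_spec_mult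
        Re_trace_spec[OF P(1)] Re_trace_spec[OF V(1)] overlap_sum_affine[OF P(1) V(1), symmetric]
        g_def left_diff_distrib[of _ _ "overlap P V _ _"] sum_subtractf)
  have nn: "0 \<le> g i j * overlap P V i j" for i j
    by (intro mult_nonneg_nonneg g(1) overlap_nonneg)
  then have "0 \<le> (\<Sum>i\<in>UNIV. \<Sum>j\<in>UNIV. g i j * overlap P V i j)" by (intro sum_nonneg)
  with eq show "p * Re (trace X) + (1 - p) * Re (trace Q) \<le> Re (trace (mat_powr X p ** mat_powr Q (1 - p)))"
    by simp
  assume "Re (trace (mat_powr X p ** mat_powr Q (1 - p))) = p * Re (trace X) + (1 - p) * Re (trace Q)"
  with eq have "\<forall>i. \<forall>j. g i j * overlap P V i j = 0"
    using nn by (simp add: sum_nonneg_eq_0_iff sum_nonneg del: mult_eq_0_iff)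
  then show "X = Q" unfolding P(2) V(2) using g(2)
    by (intro spec_eq_if_overlap P(1) V(1)) auto
qed

text \<open>Klein's inequality for the convex function t^s: Tr V^s lies above its linearization at
  U.\<close>

lemma trace_klein:
  assumes s: "s < 0 \<or> 1 < s" and U: "posdef U" and V: "posdef V"
  shows "s * Re (trace (mat_powr U (s - 1) ** V)) + (1 - s) * Re (trace (mat_powr U s)) \<le> Re (trace (mat_powr V s))"
proof -
  obtain P x where P: "unitary P" "U = spec P x" "\<And>i. 0 < x i" using posdef_obtain_spec[OF U] by blast
  obtain W y where W: "unitary W" "V = spec W y" "\<And>i. 0 < y i" using posdef_obtain_spec[OF V] by blast
  have 1: "Re (trace (mat_powr U (s - 1) ** V)) = (\<Sum>i\<in>UNIV. \<Sum>j\<in>UNIV. x i powr (s - 1) * y j * overlap P W i j)"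
    by (simp only: P(2) W(2) mat_powr_spec[OF P(1)] Re_trace_spec_mult)
  have 2: "Re (trace (mat_powr U s)) = (\<Sum>i\<in>UNIV. \<Sum>j\<in>UNIV. x i powr s * overlap P W i j)"
    by (simp only: P(2) mat_powr_spec[OF P(1)] Re_trace_spec[OF P(1)] overlap_sum_row[OF P(1) W(1)])
  have "s * Re (trace (mat_powr U (s - 1) ** V)) + (1 - s) * Re (trace (mat_powr U s))
      = (\<Sum>i\<in>UNIV. \<Sum>j\<in>UNIV. (s * (y j * x i powr (s - 1)) + (1 - s) * x i powr s) * overlap P W i j)"
    unfolding 1 2 sum_distrib_left sum.distrib[symmetric]
    by (intro sum.cong refl) (simp add: algebra_simps)
  also have "\<dots> \<le> (\<Sum>i\<in>UNIV. \<Sum>j\<in>UNIV. y j powr s * overlap P W i j)"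
    by (intro sum_mono mult_right_mono powr_tangent s P W overlap_nonneg)
  also have "\<dots> = Re (trace (mat_powr V s))"
    by (simp add: overlap_sum_col P W mat_powr_spec Re_trace_spec)
  finally show ?thesis .
qed

text \<open>For s > 1 the power is in general not operator monotone, but its trace is monotone.
  Linearize at U if s > 1 and at V if s < 0; the linear term has a sign because a power of the base
  point is paired with V - U.\<close>

lemma trace_mat_powr_mono:
  assumes U: "posdef U" and V: "posdef V" and le: "U \<preceq> V"
  shows "1 < s \<Longrightarrow> Re (trace (mat_powr U s)) \<le> Re (trace (mat_powr V s))"
    and "s < 0 \<Longrightarrow> Re (trace (mat_powr V s)) \<le> Re (trace (mat_powr U s))"
proof -
  have self: "Re (trace (mat_powr W (s - 1) ** W)) = Re (trace (mat_powr W s))" if "posdef W" for W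
    using mat_powr_add[OF that, of "s - 1" 1] by (simp add: mat_powr_one posdef_imp_psd that)
  {
    assume s: "1 < s"
    have "s * Re (trace (mat_powr U s)) \<le> s * Re (trace (mat_powr U (s - 1) ** V))"
      using loewner_trace_mult[OF posdef_imp_psd[OF posdef_mat_powr[OF U]] le, of "s - 1"] s
      by (simp add: self U)
    then show "Re (trace (mat_powr U s)) \<le> Re (trace (mat_powr V s))"
      using trace_klein[of s U V] s U V unfolding left_diff_distrib mult_1 by linarith
  next
    assume s: "s < 0"
    have "s * Re (trace (mat_powr V s)) \<le> s * Re (trace (mat_powr V (s - 1) ** U))"
      using loewner_trace_mult[OF posdef_imp_psd[OF posdef_mat_powr[OF V]] le, of "s - 1"] s
      by (simp add: self V)
    then show "Re (trace (mat_powr V s)) \<le> Re (trace (mat_powr U s))"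
      using trace_klein[of s V U] s U V unfolding left_diff_distrib mult_1 by linarith
  }
qed

section \<open>Thompson-metric balls\<close>

text \<open>The condition under the infimum of \<open>thompson\<close>, without r \<ge> 0.\<close>

definition thompson_near :: "real \<Rightarrow> complex ^ 'n::finite ^ 'n \<Rightarrow> complex ^ 'n ^ 'n \<Rightarrow> bool" where
  "thompson_near r V U \<longleftrightarrow> exp (- r) *\<^sub>R V \<preceq> U \<and> U \<preceq> exp r *\<^sub>R V"

lemma thompson_near_sym: "thompson_near r V U \<Longrightarrow> thompson_near r U V"
  unfolding thompson_near_def
  using loewner_scaleR[of "exp (- r) *\<^sub>R V" U "exp r"] loewner_scaleR[of U "exp r *\<^sub>R V" "exp (- r)"]
  by (simp add: exp_add[symmetric])

lemma thompson_near_trans: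
  assumes "thompson_near r V U" "thompson_near s U W"
  shows "thompson_near (r + s) V W"
proof -
  have "exp (- s) *\<^sub>R exp (- r) *\<^sub>R V \<preceq> exp (- s) *\<^sub>R U" "exp s *\<^sub>R U \<preceq> exp s *\<^sub>R exp r *\<^sub>R V"
    using assms(1) by (auto simp: thompson_near_def intro!: loewner_scaleR simp del: scaleR_scaleR)
  then show ?thesis
    using assms(2) by (auto simp: thompson_near_def exp_add[symmetric] add.commute intro: loewner_trans)
qed

lemma thompson_near_mono:
  assumes "psd V" "thompson_near r V U" "r \<le> s"
  shows "thompson_near s V U"
  using assms loewner_scaleR_mono[of V "exp (- s)" "exp (- r)"] loewner_scaleR_mono[of V "exp r" "exp s"]
  by (auto simp: thompson_near_def intro: loewner_trans)

lemma thompson_near_scaleR_self: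
  assumes "psd V" "exp (- r) \<le> c" "c \<le> exp r"
  shows "thompson_near r V (c *\<^sub>R V)"
  using assms by (simp add: thompson_near_def loewner_scaleR_mono)

text \<open>Compare through multiples of the identity: with b the largest eigenvalue of V and a the
  smallest of U, exp (- r) b \<le> a gives one inequality; exchanging the matrices gives the
  other.\<close>

lemma thompson_near_exists:
  assumes V: "posdef V" and U: "posdef U"
  obtains r where "0 \<le> r" "thompson_near r V U"
proof -
  have *: "\<exists>r\<ge>0. exp (- r) *\<^sub>R V \<preceq> U" if V: "posdef V" and U: "posdef U" for U V :: "complex ^ 'n ^ 'n"
  proof -
    obtain P l where P: "unitary P" "U = spec P l" "\<And>i. 0 < l i" using posdef_obtain_spec[OF U] by blast
    obtain W m where W: "unitary W" "V = spec W m" "\<And>i. 0 < m i" using posdef_obtain_spec[OF V] by blast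
    define a where "a = Min (range l)"
    define b where "b = Max (range m)"
    have a: "a \<le> l i" and b: "m i \<le> b" for i by (simp_all add: a_def b_def)
    have "a \<in> range l" "b \<in> range m" unfolding a_def b_def by (auto intro: Min_in Max_in)
    then have ab: "0 < a" "0 < b" using P(3) W(3) by auto
    define r where "r = max 0 (ln (b / a))"
    have "b / a = exp (ln (b / a))" using ab by simp
    also have "\<dots> \<le> exp r" by (subst exp_le_cancel_iff) (simp add: r_def)
    finally have "b / a \<le> exp r" .
    then have rb: "exp (- r) * b \<le> a" using ab by (simp add: exp_minus field_simps)
    have "x \<bullet> ((exp (- r) *\<^sub>R V) *v x) \<le> x \<bullet> (U *v x)" for x
    proof -
      have "x \<bullet> ((exp (- r) *\<^sub>R V) *v x) = (\<Sum>i\<in>UNIV. (exp (- r) * m i) * (cmod ((adj W *v x) $ i))\<^sup>2)"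
        by (simp add: W(2) spec_scaleR quad_form_inner[symmetric] quad_form_spec)
      also have "\<dots> \<le> (\<Sum>i\<in>UNIV. a * (cmod ((adj W *v x) $ i))\<^sup>2)"
        by (intro sum_mono mult_right_mono order_trans[OF mult_left_mono[OF b] rb]) auto
      also have "\<dots> = a * (norm x)\<^sup>2" by (simp add: sum_distrib_left[symmetric] unitary_sum_cmod W(1))
      also have "\<dots> = (\<Sum>i\<in>UNIV. a * (cmod ((adj P *v x) $ i))\<^sup>2)"
        by (simp add: sum_distrib_left[symmetric] unitary_sum_cmod P(1))
      also have "\<dots> \<le> (\<Sum>i\<in>UNIV. l i * (cmod ((adj P *v x) $ i))\<^sup>2)"
        using a by (intro sum_mono mult_right_mono) auto
      also have "\<dots> = x \<bullet> (U *v x)"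
        by (simp add: P(2) quad_form_inner[symmetric] quad_form_spec)
      finally show ?thesis .
    qed
    then have "exp (- r) *\<^sub>R V \<preceq> U" by (simp add: loewner_posdef_iff posdef_scaleR V U)
    moreover have "0 \<le> r" by (simp add: r_def)
    ultimately show ?thesis by blast
  qed
  obtain r1 where r1: "0 \<le> r1" "exp (- r1) *\<^sub>R V \<preceq> U" using *[OF V U] by blast
  obtain r2 where r2: "0 \<le> r2" "exp (- r2) *\<^sub>R U \<preceq> V" using *[OF U V] by blast
  define r where "r = max r1 r2"
  have "exp (- r) *\<^sub>R V \<preceq> exp (- r1) *\<^sub>R V" "exp r2 *\<^sub>R V \<preceq> exp r *\<^sub>R V"
    using posdef_imp_psd[OF V] by (auto intro!: loewner_scaleR_mono simp: r_def)
  moreover have "U \<preceq> exp r2 *\<^sub>R V"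
    using loewner_scaleR[OF r2(2), of "exp r2"] by (simp add: exp_add[symmetric])
  ultimately have "thompson_near r V U" using r1 by (auto simp: thompson_near_def intro: loewner_trans)
  then show thesis using that[of r] r1 by (simp add: r_def)
qed

text \<open>The power turns the factors exp r and exp (- r) into exp (p r) and exp (- p r); for
  negative p the two Loewner inequalities trade places.\<close>

lemma thompson_near_mat_powr:
  assumes V: "posdef V" and U: "posdef U" and p: "\<bar>p\<bar> \<le> 1" and th: "thompson_near r V U"
  shows "thompson_near (\<bar>p\<bar> * r) (mat_powr V p) (mat_powr U p)"
proof -
  have sc: "mat_powr (exp t *\<^sub>R V) q = exp (t * q) *\<^sub>R mat_powr V q" for t q
    by (simp add: mat_powr_scaleR posdef_imp_psd V powr_def mult.commute)
  have pd: "posdef (exp t *\<^sub>R V)" for t by (simp add: posdef_scaleR V)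
  show ?thesis
  proof (cases "0 \<le> p")
    case True
    then show ?thesis
      using loewner_heinz[OF pd U, of "- r" p] loewner_heinz[OF U pd, of r p] p th
      by (simp add: thompson_near_def sc mult.commute)
  next
    case False
    then show ?thesis
      using loewner_heinz_neg[OF pd U, of "- r" "- p"] loewner_heinz_neg[OF U pd, of r "- p"] p th
      by (simp add: thompson_near_def sc mult.commute)
  qed
qed

lemma trace_mult_scaleR_right: "Re (trace (A ** (c *\<^sub>R (U :: complex ^ 'n ^ 'n)))) = c * Re (trace (A ** U))"
  by (simp add: matrix_mult_scaleR_right trace_scaleR)

lemma thompson_near_trace:
  assumes "psd A" "thompson_near r V U"
  shows "exp (- r) * Re (trace (A ** V)) \<le> Re (trace (A ** U))" "Re (trace (A ** U)) \<le> exp r * Re (trace (A ** V))"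
  using assms loewner_trace_mult[of A "exp (- r) *\<^sub>R V" U] loewner_trace_mult[of A U "exp r *\<^sub>R V"]
  by (auto simp: thompson_near_def trace_mult_scaleR_right)

section \<open>Limits and boundedness\<close>

lemma adj_tendsto: "X \<longlonglongrightarrow> L \<Longrightarrow> (\<lambda>n. adj (X n)) \<longlonglongrightarrow> adj L"
  unfolding adj_def by (intro tendsto_intros)

lemma matrix_vector_mult_tendsto:
  "X \<longlonglongrightarrow> L \<Longrightarrow> (\<lambda>n. X n *v (x :: complex ^ 'n)) \<longlonglongrightarrow> L *v x"
  unfolding matrix_vector_mult_def by (intro tendsto_intros)

lemma psd_limit:
  assumes "X \<longlonglongrightarrow> L" "\<And>n. psd (X n)"
  shows "psd L"
proof -
  have "X \<longlonglongrightarrow> adj L" using adj_tendsto[OF assms(1)] assms(2) by (simp add: psd_adj)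
  then have "adj L = L" using assms(1) LIMSEQ_unique by blast
  moreover have "0 \<le> x \<bullet> (L *v x)" for x
  proof (rule LIMSEQ_le_const)
    show "(\<lambda>n. x \<bullet> (X n *v x)) \<longlonglongrightarrow> x \<bullet> (L *v x)"
      by (intro tendsto_intros matrix_vector_mult_tendsto assms(1))
    show "\<exists>N. \<forall>n\<ge>N. 0 \<le> x \<bullet> (X n *v x)" using assms(2) by (auto simp: psd_iff)
  qed
  ultimately show ?thesis by (simp add: psd_iff)
qed

lemma loewner_limit:
  assumes "X \<longlonglongrightarrow> L" "Y \<longlonglongrightarrow> M" "\<And>n. X n \<preceq> Y n"
  shows "L \<preceq> M"
  unfolding loewner_le_def
  by (rule psd_limit[OF tendsto_diff[OF assms(2,1)]]) (use assms(3) in \<open>simp add: loewner_le_def\<close>)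

lemma thompson_near_limit:
  assumes "r \<longlonglongrightarrow> s" "X \<longlonglongrightarrow> L" "Y \<longlonglongrightarrow> M" "\<And>n. thompson_near (r n) (X n) (Y n)"
  shows "thompson_near s L M"
  unfolding thompson_near_def
proof
  show "exp (- s) *\<^sub>R L \<preceq> M"
    by (rule loewner_limit[of "\<lambda>n. exp (- r n) *\<^sub>R X n" _ Y]) (intro tendsto_intros assms, use assms in \<open>auto simp: thompson_near_def\<close>)
  show "M \<preceq> exp s *\<^sub>R L"
    by (rule loewner_limit[of Y _ "\<lambda>n. exp (r n) *\<^sub>R X n"]) (intro tendsto_intros assms, use assms in \<open>auto simp: thompson_near_def intro!: tendsto_intros\<close>)
qed

lemma thompson_near_zero: "thompson_near 0 V U \<Longrightarrow> V = U"
  by (simp add: thompson_near_def loewner_antisym)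

text \<open>The norm is the Frobenius norm, that is the l2 norm of the eigenvalues, and the trace is
  their l1 norm. This bounds the iterates in the search for a fixed point.\<close>

lemma norm_le_trace:
  assumes "psd A"
  shows "norm A \<le> Re (trace A)"
proof -
  obtain P l where P: "unitary P" "A = spec P l" "\<And>i. 0 \<le> l i" using psd_obtain_spec[OF assms] by blast
  have "(norm A)\<^sup>2 = (\<Sum>i\<in>UNIV. \<Sum>j\<in>UNIV. (cmod (A $ i $ j))\<^sup>2)"
    by (simp add: norm_vec_def L2_set_def sum_nonneg)
  also have "\<dots> = Re (trace (A ** adj A))"
    by (simp add: trace_def matrix_matrix_mult_def adj_def complex_mult_cnj cmod_power2)
  also have "\<dots> = (\<Sum>i\<in>UNIV. (l i)\<^sup>2)"
    by (simp add: P(2) adj_spec spec_mult P(1) Re_trace_spec power2_eq_square)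
  finally have "norm A = L2_set l UNIV"
    by (metis L2_set_def norm_ge_zero real_sqrt_unique)
  also have "\<dots> \<le> (\<Sum>i\<in>UNIV. l i)" using P(3) by (intro L2_set_le_sum)
  finally show ?thesis by (simp add: P(2) Re_trace_spec P(1))
qed

section \<open>The fixed point of the Petz-Augustin operator\<close>

lemma posdef_loewner_mono:
  assumes "posdef A" "adj B = B" "A \<preceq> B"
  shows "posdef B"
  using assms by (auto simp: posdef_iff loewner_le_iff intro: less_le_trans)

lemma posdef_mat_1: "posdef (mat 1 :: complex ^ 'n::finite ^ 'n)"
proof -
  have "adj (mat 1) = (mat 1 :: complex ^ 'n ^ 'n)" by (simp add: adj_def mat_def vec_eq_iff)
  then show ?thesis by (simp add: posdef_iff)
qed

lemma psd_trace_real: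
  assumes "psd A"
  shows "trace A = complex_of_real (Re (trace A))"
proof -
  have "cnj (trace A) = trace (adj A)" by (simp add: trace_def adj_def)
  then have "cnj (trace A) = trace A" by (simp add: psd_adj assms)
  then show ?thesis by (simp add: complex_eq_iff)
qed

lemma posdef_trace_pos: "posdef A \<Longrightarrow> 0 < Re (trace A)"
  by (erule posdef_obtain_spec) (simp add: Re_trace_spec sum_pos)

lemma trace_normalize_state:
  assumes "posdef R"
  shows "posdef (trace_normalize R)" "trace_normalize R \<in> states"
proof -
  have pos: "0 < Re (trace R)" by (rule posdef_trace_pos[OF assms])
  then show *: "posdef (trace_normalize R)" by (simp add: trace_normalize_def posdef_scaleR assms)
  have "Re (trace (trace_normalize R)) = 1" using pos by (simp add: trace_normalize_def trace_scaleR)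
  then show "trace_normalize R \<in> states"
    using psd_trace_real[OF posdef_imp_psd[OF *]] posdef_imp_psd[OF *] by (simp add: states_def)
qed

lemma matrix_add_rdistrib: "((A :: 'a::semiring_1 ^ 'm ^ 'n) + B) ** C = A ** C + B ** C"
  by (simp add: vec_eq_iff matrix_matrix_mult_def distrib_right sum.distrib)

lemma trace_sum_mult:
  "Re (trace ((\<Sum>j\<in>J. c j *\<^sub>R B j) ** (V :: complex ^ 'n::finite ^ 'n))) = (\<Sum>j\<in>J. c j * Re (trace (B j ** V)))"
proof (induction J rule: infinite_finite_induct)
  case (insert x F)
  then show ?case
    by (simp add: matrix_add_rdistrib trace_add matrix_mult_scaleR_left trace_scaleR)
qed (simp_all add: trace_def)

locale petz_augustin =
  fixes A :: "nat \<Rightarrow> complex ^ 'n::finite ^ 'n" and w :: "nat \<Rightarrow> real" and n :: nat and \<alpha> :: real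
  assumes A_states: "\<And>j. j \<in> {1..n} \<Longrightarrow> A j \<in> states"
    and full_rank: "rank (\<Sum>j=1..n. A j) = CARD('n)"
    and w_pos: "\<And>j. j \<in> {1..n} \<Longrightarrow> w j > 0"
    and w_sum: "(\<Sum>j=1..n. w j) = 1"
    and alpha: "\<alpha> \<in> {1/2<..<1} \<union> {1<..}"
begin

definition B :: "nat \<Rightarrow> complex ^ 'n ^ 'n" where
  "B j = mat_powr (A j) \<alpha>"

definition tr :: "nat \<Rightarrow> complex ^ 'n ^ 'n \<Rightarrow> real" where
  "tr j U = Re (trace (B j ** U))"

definition S :: "complex ^ 'n ^ 'n \<Rightarrow> complex ^ 'n ^ 'n" where
  "S U = (\<Sum>j=1..n. (w j / tr j U) *\<^sub>R B j)"

definition G :: "complex ^ 'n ^ 'n \<Rightarrow> real" where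
  "G U = (\<Sum>j=1..n. w j * ln (tr j U))"

definition \<kappa> :: real where
  "\<kappa> = \<bar>1 - 1 / \<alpha>\<bar>"

abbreviation T :: "complex ^ 'n ^ 'n \<Rightarrow> complex ^ 'n ^ 'n" where
  "T \<equiv> petz_augustin_operator n w A \<alpha>"

abbreviation F :: "complex ^ 'n ^ 'n \<Rightarrow> ereal" where
  "F \<equiv> petz_augustin_objective n w A \<alpha>"

lemma alpha_pos: "0 < \<alpha>" and alpha_half: "1 / 2 < \<alpha>" and alpha_ne: "\<alpha> \<noteq> 1"
  using alpha by auto

lemma kappa: "\<kappa> = \<bar>(1 - \<alpha>) / \<alpha>\<bar>" "0 < \<kappa>" "\<kappa> < 1"
proof -
  have e: "1 - 1 / \<alpha> = - ((1 - \<alpha>) / \<alpha>)" using alpha_pos by (simp add: field_simps)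
  show *: "\<kappa> = \<bar>(1 - \<alpha>) / \<alpha>\<bar>" by (simp only: \<kappa>_def e abs_minus_cancel)
  show "0 < \<kappa>" using alpha_pos alpha_ne by (simp add: *)
  show "\<kappa> < 1" using alpha_pos alpha_half by (auto simp: * abs_less_iff field_simps)
qed

lemma T_eq: "T U = mat_powr (S U) ((1 - \<alpha>) / \<alpha>)"
  by (simp add: petz_augustin_operator_def S_def tr_def B_def)

lemma psd_A: "j \<in> {1..n} \<Longrightarrow> psd (A j)"
  using A_states by (simp add: states_def)

lemma psd_B: "j \<in> {1..n} \<Longrightarrow> psd (B j)"
  by (simp add: B_def psd_A psd_mat_powr)

lemma B_kernel: "j \<in> {1..n} \<Longrightarrow> B j *v x = 0 \<Longrightarrow> A j *v x = 0"
  unfolding B_def using alpha_pos by (intro mat_powr_kernel[OF psd_A, of j \<alpha>]) auto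

lemma B_nonzero:
  assumes "j \<in> {1..n}"
  shows "B j \<noteq> 0"
proof
  assume "B j = 0"
  then have "A j *v x = 0" for x using B_kernel[OF assms, of x] by simp
  then have "A j = 0" by (metis matrix_eq matrix_vector_mult_0)
  then show False using A_states[OF assms] by (simp add: states_def trace_def)
qed

lemma tr_pos: "j \<in> {1..n} \<Longrightarrow> posdef U \<Longrightarrow> 0 < tr j U"
  unfolding tr_def by (intro psd_trace_mult_pos psd_B B_nonzero)

lemma tr_scaleR: "tr j (c *\<^sub>R U) = c * tr j U"
  by (simp add: tr_def trace_mult_scaleR_right)

lemma tr_thompson_near:
  assumes "j \<in> {1..n}" "thompson_near r V U"
  shows "exp (- r) * tr j V \<le> tr j U" "tr j U \<le> exp r * tr j V"
  unfolding tr_def using thompson_near_trace[OF psd_B] assms by auto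

lemma sum_A_kernel:
  assumes "\<And>j. j \<in> {1..n} \<Longrightarrow> A j *v x = 0"
  shows "x = 0"
proof -
  have "(\<Sum>j\<in>J. A j) *v x = (\<Sum>j\<in>J. A j *v x)" for J
    by (induction J rule: infinite_finite_induct) (auto simp: matrix_vector_mult_add_rdistrib)
  then have "(\<Sum>j=1..n. A j) *v x = 0" using assms by simp
  then show ?thesis using full_rank_kernel full_rank by blast
qed

text \<open>The coefficients are positive, so a vector with vanishing form is killed by every B_j,
  hence by every A_j, and full rank of the sum leaves only 0.\<close>

lemma S_posdef:
  assumes "posdef U"
  shows "posdef (S U)"
proof -
  have c: "0 < w j / tr j U" if "j \<in> {1..n}" for j
    using w_pos[OF that] tr_pos[OF that assms] by simp
  have psd: "psd (S U)"
    unfolding S_def using c by (intro psd_sum psd_scaleR psd_B) (auto simp: less_imp_le)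
  have "0 < x \<bullet> (S U *v x)" if "x \<noteq> 0" for x
  proof (rule ccontr)
    assume "\<not> 0 < x \<bullet> (S U *v x)"
    then have 0: "x \<bullet> (S U *v x) = 0" using psd by (auto simp: psd_iff intro: antisym)
    have "x \<bullet> ((\<Sum>j\<in>J. (w j / tr j U) *\<^sub>R B j) *v x) = (\<Sum>j\<in>J. (w j / tr j U) * (x \<bullet> (B j *v x)))" for J
      by (induction J rule: infinite_finite_induct)
        (auto simp: matrix_vector_mult_add_rdistrib matrix_vector_mult_scaleR_left inner_add_right)
    with 0 have "(\<Sum>j=1..n. (w j / tr j U) * (x \<bullet> (B j *v x))) = 0" by (simp add: S_def)
    moreover have "0 \<le> (w j / tr j U) * (x \<bullet> (B j *v x))" if "j \<in> {1..n}" for j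
      using c[OF that] psd_B[OF that] by (intro mult_nonneg_nonneg) (auto simp: psd_iff)
    ultimately have *: "(w j / tr j U) * (x \<bullet> (B j *v x)) = 0" if "j \<in> {1..n}" for j
      using that sum_nonneg_eq_0_iff[of "{1..n}"] by (metis (no_types, lifting) finite_atLeastAtMost)
    have "A j *v x = 0" if "j \<in> {1..n}" for j
    proof -
      have "x \<bullet> (B j *v x) = 0" using *[OF that] c[OF that] by (metis less_irrefl mult_eq_0_iff)
      then show ?thesis using psd_quad_zero(1) psd_B B_kernel that by blast
    qed
    then show False using sum_A_kernel that by blast
  qed
  then show ?thesis using psd by (simp add: posdef_iff psd_iff)
qed

lemma T_posdef: "posdef U \<Longrightarrow> posdef (T U)"
  by (simp add: T_eq posdef_mat_powr S_posdef)

lemma trace_S_mult: "Re (trace (S U ** V)) = (\<Sum>j=1..n. w j / tr j U * tr j V)"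
  unfolding S_def trace_sum_mult tr_def ..

text \<open>This normalization is the reason why fixed points correspond to matrices of trace
  one.\<close>

lemma trace_S_self: "posdef U \<Longrightarrow> Re (trace (S U ** U)) = 1"
  unfolding trace_S_mult w_sum[symmetric] using tr_pos by (intro sum.cong) (auto simp: less_imp_neq[THEN not_sym])

lemma S_thompson_near:
  assumes U: "posdef U" and V: "posdef V" and th: "thompson_near r U V"
  shows "thompson_near r (S U) (S V)"
proof -
  have "exp (- r) *\<^sub>R (w j / tr j U) *\<^sub>R B j \<preceq> (w j / tr j V) *\<^sub>R B j"
    and "(w j / tr j V) *\<^sub>R B j \<preceq> exp r *\<^sub>R (w j / tr j U) *\<^sub>R B j" if j: "j \<in> {1..n}" for j
  proof -
    have "exp (- r) * (w j / tr j U) \<le> w j / tr j V" "w j / tr j V \<le> exp r * (w j / tr j U)"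
      using tr_thompson_near[OF j th] tr_pos[OF j] U V w_pos[OF j] by (simp_all add: field_simps exp_minus)
    then show "exp (- r) *\<^sub>R (w j / tr j U) *\<^sub>R B j \<preceq> (w j / tr j V) *\<^sub>R B j"
      and "(w j / tr j V) *\<^sub>R B j \<preceq> exp r *\<^sub>R (w j / tr j U) *\<^sub>R B j"
      by (simp_all only: scaleR_scaleR loewner_scaleR_mono[OF psd_B[OF j]])
  qed
  then show ?thesis
    unfolding thompson_near_def S_def scaleR_sum_right by (intro conjI loewner_sum)
qed

lemma T_thompson_near:
  assumes U: "posdef U" and V: "posdef V" and th: "thompson_near r U V"
  shows "thompson_near (\<kappa> * r) (T U) (T V)"
  using thompson_near_mat_powr[OF S_posdef[OF U] S_posdef[OF V] _ S_thompson_near[OF assms], of "(1 - \<alpha>) / \<alpha>"] kappa(3)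
  unfolding T_eq kappa(1) by simp

text \<open>Banach's argument with Loewner inequalities: boundedness supplies a convergent
  subsequence, and the inequalities defining the balls survive the limit.\<close>

lemma T_fixed_point: "\<exists>U. posdef U \<and> T U = U"
proof -
  define X where "X t = (T ^^ t) (mat 1)" for t
  have X: "posdef (X t)" for t
    by (induction t) (simp_all add: X_def posdef_mat_1 T_posdef)
  have X_Suc: "X (Suc t) = T (X t)" for t by (simp add: X_def)
  obtain r where r: "0 \<le> r" "thompson_near r (X 0) (X 1)" using thompson_near_exists[OF X X] by blast
  \<comment> \<open>The sum of the geometric series with first term r and ratio \<kappa>.\<close>
  define C where "C = r / (1 - \<kappa>)"
  have C: "0 \<le> C" using r kappa by (simp add: C_def)
  have step: "thompson_near (\<kappa> ^ t * r) (X t) (X (Suc t))" for t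
  proof (induction t)
    case (Suc t)
    from T_thompson_near[OF X X this] show ?case by (simp add: X_Suc mult.assoc)
  qed (use r in simp)
  \<comment> \<open>The exact partial geometric sum lets the triangle inequality close the
    induction; the factor in m is dropped afterwards.\<close>
  have "thompson_near (\<kappa> ^ t * C * (1 - \<kappa> ^ m)) (X t) (X (t + m))" for t m
  proof (induction m)
    case 0
    then show ?case by (simp add: thompson_near_def loewner_refl)
  next
    case (Suc m)
    have "\<kappa> ^ t * C * (1 - \<kappa> ^ m) + \<kappa> ^ (t + m) * r = \<kappa> ^ t * C * (1 - \<kappa> ^ Suc m)"
    proof -
      have "r = C * (1 - \<kappa>)" using kappa(3) by (simp add: C_def)
      show ?thesis unfolding \<open>r = C * (1 - \<kappa>)\<close> by (simp add: algebra_simps power_add)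
    qed
    then show ?case using thompson_near_trans[OF Suc step[of "t + m"]] by simp
  qed
  then have near: "thompson_near (\<kappa> ^ t * C) (X t) (X (t + m))" for t m
    by (rule thompson_near_mono[OF posdef_imp_psd[OF X]])
      (use C kappa in \<open>simp add: mult_left_le mult_nonneg_nonneg\<close>)
  have "norm (X m) \<le> exp C * Re (trace (X 0))" for m
  proof -
    have "Re (trace (X m)) \<le> exp C * Re (trace (X 0))"
      using thompson_near_trace(2)[OF posdef_imp_psd[OF posdef_mat_1] near[of 0 m]] by simp
    then show ?thesis using norm_le_trace[OF posdef_imp_psd[OF X]] order_trans by blast
  qed
  then have "bounded (range X)" by (auto simp: bounded_iff)
  then obtain f L where f: "strict_mono (f :: nat \<Rightarrow> nat)" and L: "(X \<circ> f) \<longlonglongrightarrow> L"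
    using bounded_imp_convergent_subsequence by blast
  have lim: "thompson_near (\<kappa> ^ t * C) (X t) L" for t
  proof (rule thompson_near_limit[OF tendsto_const tendsto_const])
    \<comment> \<open>The shift by t guarantees f (k + t) \<ge> t, so every term is a later iterate
      than X t.\<close>
    show "(\<lambda>k. X (f (k + t))) \<longlonglongrightarrow> L"
      using LIMSEQ_ignore_initial_segment[OF L, of t] by (simp add: o_def)
    show "thompson_near (\<kappa> ^ t * C) (X t) (X (f (k + t)))" for k
      using near[of t "f (k + t) - t"] seq_suble[OF f, of "k + t"] by simp
  qed
  \<comment> \<open>A limit of positive definite matrices may be singular; the lower bound exp (- C)
    X 0 excludes this.\<close>
  have "psd L" using psd_limit[OF L] posdef_imp_psd[OF X] by simp
  then have "posdef L"
    using lim[of 0] by (intro posdef_loewner_mono[OF posdef_scaleR[OF X[of 0], of "exp (- C)"]])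
      (auto simp: thompson_near_def psd_adj)
  \<comment> \<open>Both L and T L lie near X (t + 1), at a radius that tends to 0.\<close>
  have close: "thompson_near (\<kappa> ^ Suc t * C + \<kappa> ^ Suc t * C) (T L) L" for t
  proof -
    have "thompson_near (\<kappa> ^ Suc t * C) (X (Suc t)) (T L)"
      using T_thompson_near[OF X \<open>posdef L\<close> lim[of t]] by (simp add: X_Suc mult.assoc)
    then show ?thesis using thompson_near_trans thompson_near_sym lim by blast
  qed
  have "(\<lambda>t. \<kappa> ^ Suc t * C + \<kappa> ^ Suc t * C) \<longlonglongrightarrow> 0 * C + 0 * C"
    using kappa by (intro tendsto_intros LIMSEQ_Suc LIMSEQ_power_zero) auto
  from thompson_near_limit[OF this tendsto_const tendsto_const close] have "thompson_near 0 (T L) L" by simp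
  then show ?thesis using thompson_near_zero \<open>posdef L\<close> by blast
qed

section \<open>Minimizers are fixed points\<close>

lemma index_nonempty: "{1..n} \<noteq> {}"
  using w_sum by force

lemma petz_trace_eq: "petz_trace \<alpha> (A j) R = tr j (mat_powr R (1 - \<alpha>))"
  by (simp add: petz_trace_def tr_def B_def)

lemma F_eq:
  assumes "\<And>j. j \<in> {1..n} \<Longrightarrow> petz_renyi \<alpha> (A j) R \<noteq> \<infinity>"
  shows "F R = ereal (G (mat_powr R (1 - \<alpha>)) / (\<alpha> - 1))"
proof -
  have "ereal (w j) * petz_renyi \<alpha> (A j) R = ereal (w j * ln (tr j (mat_powr R (1 - \<alpha>))) / (\<alpha> - 1))"
    if "j \<in> {1..n}" for j
    using assms[OF that] by (auto simp: petz_renyi_def petz_trace_eq split: if_splits)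
  then have "F R = (\<Sum>j=1..n. ereal (w j * ln (tr j (mat_powr R (1 - \<alpha>))) / (\<alpha> - 1)))"
    unfolding petz_augustin_objective_def by (rule sum.cong[OF refl])
  also have "\<dots> = ereal (G (mat_powr R (1 - \<alpha>)) / (\<alpha> - 1))"
    by (simp add: G_def sum_divide_distrib)
  finally show ?thesis .
qed

lemma F_posdef:
  assumes R: "posdef R"
  shows "F R = ereal (G (mat_powr R (1 - \<alpha>)) / (\<alpha> - 1))"
proof (rule F_eq)
  fix j assume j: "j \<in> {1..n}"
  have "x = 0" if "R *v x = 0" for x using R that unfolding posdef_iff by force
  then show "petz_renyi \<alpha> (A j) R \<noteq> \<infinity>"
    using tr_pos[OF j posdef_mat_powr[OF R], of "1 - \<alpha>"]
    by (auto simp: petz_renyi_def petz_trace_eq dest: \<open>\<And>x. R *v x = 0 \<Longrightarrow> x = 0\<close>)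
qed

text \<open>Through this a minimizer inherits the positivity of every trace and, for \<alpha> > 1,
  the kernel inclusions.\<close>

lemma F_finite:
  assumes "F R \<noteq> \<infinity>" "j \<in> {1..n}"
  shows "petz_renyi \<alpha> (A j) R \<noteq> \<infinity>"
proof
  assume "petz_renyi \<alpha> (A j) R = \<infinity>"
  then have "ereal (w j) * petz_renyi \<alpha> (A j) R = \<infinity>"
    using w_pos[OF assms(2)] by simp
  then have "F R = \<infinity>"
    unfolding petz_augustin_objective_def using assms(2) by (auto simp: sum_Pinfty)
  then show False using assms(1) by simp
qed

lemma minimizer_le:
  assumes "is_arg_min F (\<lambda>R. R \<in> states) Qs" "R \<in> states"
  shows "F Qs \<le> F R"
  using assms by (auto simp: is_arg_min_def not_less)

lemma minimizer_finite:
  assumes "is_arg_min F (\<lambda>R. R \<in> states) Qs"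
  shows "F Qs \<noteq> \<infinity>"
  using minimizer_le[OF assms trace_normalize_state(2)[OF posdef_mat_1]]
  by (auto simp: F_posdef trace_normalize_state(1)[OF posdef_mat_1])

lemma mat_powr_normalize:
  assumes Q: "posdef Q"
  shows "mat_powr (trace_normalize Q) (1 - \<alpha>) = (Re (trace Q) powr (\<alpha> - 1)) *\<^sub>R mat_powr Q (1 - \<alpha>)"
proof -
  have "(1 / Re (trace Q)) powr (1 - \<alpha>) = Re (trace Q) powr (\<alpha> - 1)"
    using posdef_trace_pos[OF Q] powr_minus_divide[of "Re (trace Q)" "1 - \<alpha>"] by (simp add: powr_divide)
  then show ?thesis
    using posdef_trace_pos[OF Q] by (simp add: trace_normalize_def mat_powr_scaleR posdef_imp_psd[OF Q])
qed

lemma G_normalize: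
  assumes Q: "posdef Q"
  shows "G (mat_powr (trace_normalize Q) (1 - \<alpha>)) = G (mat_powr Q (1 - \<alpha>)) + (\<alpha> - 1) * ln (Re (trace Q))"
proof -
  have "ln (tr j (mat_powr (trace_normalize Q) (1 - \<alpha>))) = ln (tr j (mat_powr Q (1 - \<alpha>))) + (\<alpha> - 1) * ln (Re (trace Q))"
    if "j \<in> {1..n}" for j
    using posdef_trace_pos[OF Q] tr_pos[OF that posdef_mat_powr[OF Q], of "1 - \<alpha>"]
    by (simp add: mat_powr_normalize[OF Q] tr_scaleR ln_mult ln_powr)
  then have "G (mat_powr (trace_normalize Q) (1 - \<alpha>))
      = (\<Sum>j=1..n. w j * (ln (tr j (mat_powr Q (1 - \<alpha>))) + (\<alpha> - 1) * ln (Re (trace Q))))"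
    unfolding G_def by simp
  then show ?thesis
    unfolding distrib_left sum.distrib sum_distrib_right[symmetric] w_sum by (simp add: G_def)
qed

text \<open>Jensen for the logarithm: the weighted mean of the ratios Tr[B_j V] / Tr[B_j U] is Tr[(S U) V].\<close>

lemma G_diff_le:
  assumes U: "posdef U" and V: "\<And>j. j \<in> {1..n} \<Longrightarrow> 0 < tr j V"
  shows "G V - G U \<le> ln (Re (trace (S U ** V)))"
proof -
  have "w j * ln (tr j V) - w j * ln (tr j U) = w j * ln (tr j V / tr j U)" if "j \<in> {1..n}" for j
    using tr_pos[OF that U] V[OF that] by (simp add: ln_div right_diff_distrib)
  then have "G V - G U = (\<Sum>j=1..n. w j * ln (tr j V / tr j U))"
    unfolding G_def sum_subtractf[symmetric] by (intro sum.cong refl)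
  also have "\<dots> \<le> ln (\<Sum>j=1..n. w j *\<^sub>R (tr j V / tr j U))"
    using tr_pos[OF _ U] V w_pos w_sum index_nonempty
    by (intro concave_on_sum[OF _ _ ln_concave]) (auto simp: less_imp_le)
  finally show ?thesis by (simp add: trace_S_mult)
qed

text \<open>X is the next iterate: the exponents (1-\<alpha>)/\<alpha> and 1/(1-\<alpha>) multiply
  to 1/\<alpha>. In this form X^\<alpha> is the matrix \<open>S\<close> that occurs in the Jensen
  bound.\<close>

lemma step_trace:
  assumes Q: "posdef Q" and X: "X = mat_powr (S (mat_powr Q (1 - \<alpha>))) (1 / \<alpha>)"
  shows "posdef X" "mat_powr X \<alpha> = S (mat_powr Q (1 - \<alpha>))"
    "mat_powr X (1 - \<alpha>) = T (mat_powr Q (1 - \<alpha>))"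
    "Re (trace (mat_powr X \<alpha> ** mat_powr Q (1 - \<alpha>))) = 1"
proof -
  note S = S_posdef[OF posdef_mat_powr[OF Q]]
  show "posdef X" by (simp add: X posdef_mat_powr S)
  show *: "mat_powr X \<alpha> = S (mat_powr Q (1 - \<alpha>))"
    using alpha_pos by (simp add: X mat_powr_mat_powr mat_powr_one posdef_imp_psd S)
  show "mat_powr X (1 - \<alpha>) = T (mat_powr Q (1 - \<alpha>))"
    by (simp add: X T_eq mat_powr_mat_powr posdef_imp_psd S)
  show "Re (trace (mat_powr X \<alpha> ** mat_powr Q (1 - \<alpha>))) = 1"
    by (simp add: * trace_S_self posdef_mat_powr Q)
qed

text \<open>With V = X^(1-\<alpha>) the Jensen trace collapses to Tr[X^\<alpha> X^(1-\<alpha>)] = Tr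
  X.\<close>

lemma G_step:
  assumes Q: "posdef Q" and X: "X = mat_powr (S (mat_powr Q (1 - \<alpha>))) (1 / \<alpha>)"
  shows "G (mat_powr X (1 - \<alpha>)) \<le> G (mat_powr Q (1 - \<alpha>)) + ln (Re (trace X))"
proof -
  note st = step_trace[OF Q X]
  have "G (mat_powr X (1 - \<alpha>)) - G (mat_powr Q (1 - \<alpha>)) \<le> ln (Re (trace (mat_powr X \<alpha> ** mat_powr X (1 - \<alpha>))))"
    unfolding st(2) by (intro G_diff_le tr_pos posdef_mat_powr Q st(1))
  then show ?thesis by (simp add: mat_powr_add st(1) mat_powr_one posdef_imp_psd)
qed

text \<open>Minimality and Jensen at the fixed point give Tr[R^\<alpha> Qs^(1-\<alpha>)] \<ge> 1,
  Young's inequality for two trace-one matrices gives \<le> 1, and its equality case identifies Qs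
  with the positive definite R.\<close>

lemma minimizer_fixed_point_less:
  assumes a: "\<alpha> < 1" and m: "is_arg_min F (\<lambda>R. R \<in> states) Qs"
  shows "posdef Qs \<and> T (mat_powr Qs (1 - \<alpha>)) = mat_powr Qs (1 - \<alpha>)"
proof -
  obtain U where U: "posdef U" "T U = U" using T_fixed_point by blast
  define R where "R = mat_powr U (1 / (1 - \<alpha>))"
  define Us where "Us = mat_powr Qs (1 - \<alpha>)"
  have R: "posdef R" by (simp add: R_def posdef_mat_powr U)
  have RU: "mat_powr R (1 - \<alpha>) = U"
    using a by (simp add: R_def mat_powr_mat_powr mat_powr_one posdef_imp_psd U)
  \<comment> \<open>Undoing the outer power of \<open>T\<close> at its fixed point writes S U as
    R^\<alpha>.\<close>
  have "S U = mat_powr (T U) (\<alpha> / (1 - \<alpha>))"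
    using a alpha_pos by (simp add: T_eq mat_powr_mat_powr mat_powr_one posdef_imp_psd S_posdef U)
  then have RS: "mat_powr R \<alpha> = S U"
    by (simp add: U R_def mat_powr_mat_powr posdef_imp_psd)
  have "Re (trace R) = Re (trace (mat_powr R \<alpha> ** mat_powr R (1 - \<alpha>)))"
    by (simp add: mat_powr_add R mat_powr_one posdef_imp_psd)
  then have trR: "Re (trace R) = 1" by (simp add: RU RS trace_S_self U)
  then have R_state: "R \<in> states"
    using psd_trace_real[OF posdef_imp_psd[OF R]] posdef_imp_psd[OF R] by (simp add: states_def)
  have Qs: "psd Qs" "Re (trace Qs) = 1" using m by (simp_all add: is_arg_min_def states_def)
  note fin = F_finite[OF minimizer_finite[OF m]]
  have pos: "0 < tr j Us" if "j \<in> {1..n}" for j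
    using fin[OF that] by (auto simp: petz_renyi_def petz_trace_eq Us_def split: if_splits)
  have F_Qs: "F Qs = ereal (G Us / (\<alpha> - 1))"
    unfolding Us_def by (rule F_eq[OF fin])
  have "G Us / (\<alpha> - 1) \<le> G U / (\<alpha> - 1)"
    using minimizer_le[OF m R_state] by (simp add: F_posdef[OF R] F_Qs RU)
  then have "G U \<le> G Us" using a by (simp add: divide_right_mono_neg divide_le_cancel)
  then have "0 \<le> ln (Re (trace (S U ** Us)))" using G_diff_le[OF U(1) pos] by simp
  moreover have "0 < Re (trace (S U ** Us))"
    unfolding trace_S_mult using w_pos pos tr_pos[OF _ U(1)] index_nonempty by (intro sum_pos) auto
  ultimately have "1 \<le> Re (trace (S U ** Us))" by simp
  moreover have "Re (trace (S U ** Us)) \<le> 1"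
    using trace_young_le(1)[OF alpha_pos a R Qs(1)] by (simp add: RS Us_def trR Qs)
  ultimately have "R = Qs"
    using trace_young_le(2)[OF alpha_pos a R Qs(1)] by (simp add: RS Us_def trR Qs)
  then show ?thesis using R RU U by simp
qed

text \<open>Minimality against the normalized step and \<open>G_step\<close> give \<alpha> ln Tr X
  \<ge> 0, so Tr X \<ge> 1. The reverse Young inequality reads \<alpha> Tr X + 1 - \<alpha> \<le> 1,
  so equality holds.\<close>

lemma minimizer_fixed_point_greater:
  assumes a: "1 < \<alpha>" and m: "is_arg_min F (\<lambda>R. R \<in> states) Qs"
  shows "posdef Qs \<and> T (mat_powr Qs (1 - \<alpha>)) = mat_powr Qs (1 - \<alpha>)"
proof -
  have Qs: "psd Qs" "Re (trace Qs) = 1" using m by (simp_all add: is_arg_min_def states_def)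
  note fin = F_finite[OF minimizer_finite[OF m]]
  have "x = 0" if "Qs *v x = 0" for x
  proof (rule sum_A_kernel)
    fix j assume "j \<in> {1..n}"
    from fin[OF this] a that show "A j *v x = 0" by (auto simp: petz_renyi_def split: if_splits)
  qed
  then have pd: "posdef Qs"
    using Qs(1) psd_quad_zero(1)[OF Qs(1)] by (auto simp: posdef_iff psd_iff less_le)
  define X where "X = mat_powr (S (mat_powr Qs (1 - \<alpha>))) (1 / \<alpha>)"
  note st = step_trace[OF pd X_def]
  have "G (mat_powr Qs (1 - \<alpha>)) / (\<alpha> - 1) \<le> G (mat_powr (trace_normalize X) (1 - \<alpha>)) / (\<alpha> - 1)"
    using minimizer_le[OF m trace_normalize_state(2)[OF st(1)]]
    by (simp add: F_posdef pd trace_normalize_state(1) st(1))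
  then have "G (mat_powr Qs (1 - \<alpha>)) \<le> G (mat_powr X (1 - \<alpha>)) + (\<alpha> - 1) * ln (Re (trace X))"
    using a by (simp add: divide_le_cancel G_normalize st(1))
  also have "\<dots> \<le> G (mat_powr Qs (1 - \<alpha>)) + ln (Re (trace X)) + (\<alpha> - 1) * ln (Re (trace X))"
    using G_step[OF pd X_def] by simp
  finally have "0 \<le> \<alpha> * ln (Re (trace X))" by (simp add: algebra_simps)
  then have "1 \<le> Re (trace X)"
    using alpha_pos posdef_trace_pos[OF st(1)] by (simp add: zero_le_mult_iff)
  then have "\<alpha> * 1 \<le> \<alpha> * Re (trace X)" using alpha_pos by (intro mult_left_mono) auto
  moreover note trace_young_ge(1)[OF a posdef_imp_psd[OF st(1)] pd]
  ultimately have "X = Qs"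
    by (intro trace_young_ge(2)[OF a posdef_imp_psd[OF st(1)] pd]) (simp add: st(4) Qs)
  then show ?thesis using st(3) pd by simp
qed

lemma minimizer_fixed_point:
  assumes "is_arg_min F (\<lambda>R. R \<in> states) Qs"
  shows "posdef Qs" "T (mat_powr Qs (1 - \<alpha>)) = mat_powr Qs (1 - \<alpha>)" "Re (trace Qs) = 1"
proof -
  have "posdef Qs \<and> T (mat_powr Qs (1 - \<alpha>)) = mat_powr Qs (1 - \<alpha>)"
    using minimizer_fixed_point_less minimizer_fixed_point_greater assms alpha_ne by (metis linorder_neqE)
  then show "posdef Qs" "T (mat_powr Qs (1 - \<alpha>)) = mat_powr Qs (1 - \<alpha>)" by auto
  show "Re (trace Qs) = 1" using assms by (simp add: is_arg_min_def states_def)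
qed

section \<open>Function values and distances along the iteration\<close>

text \<open>The iterates are not normalized, so both traces enter: after normalization the step
  changes \<open>G\<close> by at most \<alpha> ln Tr X - (\<alpha> - 1) ln Tr Q, which is
  nonpositive.\<close>

lemma F_step_antimono:
  assumes a: "1 < \<alpha>" and Q: "posdef Q" and X: "X = mat_powr (S (mat_powr Q (1 - \<alpha>))) (1 / \<alpha>)"
  shows "F (trace_normalize X) \<le> F (trace_normalize Q)"
proof -
  note st = step_trace[OF Q X]
  define q where "q = Re (trace Q)"
  define x where "x = Re (trace X)"
  have q: "0 < q" and x: "0 < x" by (simp_all add: q_def x_def posdef_trace_pos Q st(1))
  \<comment> \<open>rescaling Q to the trace of X turns Young's inequality into the reverse Hoelder inequality\<close>
  define k where "k = x / q"
  have k: "0 < k" using q x by (simp add: k_def)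
  have "\<alpha> * x + (1 - \<alpha>) * (k * q) \<le> Re (trace (mat_powr X \<alpha> ** mat_powr (k *\<^sub>R Q) (1 - \<alpha>)))"
    using trace_young_ge(1)[OF a posdef_imp_psd[OF st(1)] posdef_scaleR[OF Q k]]
    by (simp add: x_def q_def trace_scaleR)
  also have "\<dots> = k powr (1 - \<alpha>)"
    using k st(4) by (simp add: mat_powr_scaleR posdef_imp_psd Q trace_mult_scaleR_right)
  also have "\<alpha> * x + (1 - \<alpha>) * (k * q) = x" using q by (simp add: k_def algebra_simps)
  finally have "ln x \<le> ln (k powr (1 - \<alpha>))" using x k by (subst ln_le_cancel_iff) simp_all
  also have "\<dots> = (1 - \<alpha>) * (ln x - ln q)" using x q by (simp add: ln_powr k_def ln_div)
  finally have "\<alpha> * ln x \<le> (\<alpha> - 1) * ln q" by (simp add: algebra_simps)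
  then have "G (mat_powr X (1 - \<alpha>)) + (\<alpha> - 1) * ln x \<le> G (mat_powr Q (1 - \<alpha>)) + (\<alpha> - 1) * ln q"
    using G_step[OF Q X] by (simp add: x_def[symmetric] algebra_simps)
  then show ?thesis
    using a by (simp add: F_posdef trace_normalize_state(1) Q st(1) G_normalize x_def q_def divide_right_mono)
qed

lemma G_thompson_near:
  assumes U: "posdef U" and V: "posdef V" and th: "thompson_near r U V"
  shows "\<bar>G V - G U\<bar> \<le> r"
proof -
  have "\<bar>ln (tr j V) - ln (tr j U)\<bar> \<le> r" if j: "j \<in> {1..n}" for j
  proof -
    have p: "0 < tr j U" "0 < tr j V" using tr_pos j U V by auto
    have "ln (exp (- r) * tr j U) \<le> ln (tr j V)" "ln (tr j V) \<le> ln (exp r * tr j U)"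
      using tr_thompson_near[OF j th] p by (simp_all add: ln_le_cancel_iff)
    then show ?thesis using p by (simp add: ln_mult)
  qed
  then have "(\<Sum>j=1..n. \<bar>w j * (ln (tr j V) - ln (tr j U))\<bar>) \<le> (\<Sum>j=1..n. w j * r)"
    using w_pos by (intro sum_mono) (auto simp: abs_mult less_imp_le)
  moreover have "\<bar>G V - G U\<bar> \<le> (\<Sum>j=1..n. \<bar>w j * (ln (tr j V) - ln (tr j U))\<bar>)"
    unfolding G_def sum_subtractf[symmetric] right_diff_distrib[symmetric] by (rule sum_abs)
  ultimately show ?thesis unfolding sum_distrib_right[symmetric] w_sum by simp
qed

text \<open>With V = Q^(1-\<alpha>) and s = 1/(1-\<alpha>), Tr Q = Tr V^s. Here s > 2 or s < 0, so
  monotonicity of this trace squeezes Tr Q between exp (- r |s|) and exp (r |s|).\<close>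

lemma trace_thompson_near:
  assumes Qs: "posdef Qs" "Re (trace Qs) = 1" and Q: "posdef Q"
    and th: "thompson_near r (mat_powr Qs (1 - \<alpha>)) (mat_powr Q (1 - \<alpha>))"
  shows "\<bar>(\<alpha> - 1) * ln (Re (trace Q))\<bar> \<le> r"
proof -
  define s where "s = 1 / (1 - \<alpha>)"
  define U where "U = mat_powr Qs (1 - \<alpha>)"
  define V where "V = mat_powr Q (1 - \<alpha>)"
  have s: "(1 - \<alpha>) * s = 1" using alpha_ne by (simp add: s_def)
  have s': "s < 0 \<or> 1 < s" using alpha by (auto simp: s_def field_simps)
  have U: "posdef U" and V: "posdef V" by (simp_all add: U_def V_def posdef_mat_powr Qs Q)
  have trU: "Re (trace (mat_powr (exp t *\<^sub>R U) s)) = exp (t * s)" for t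
    using s Qs by (simp add: mat_powr_scaleR posdef_imp_psd U trace_scaleR)
      (simp add: U_def mat_powr_mat_powr posdef_imp_psd Qs mat_powr_one powr_def mult.commute)
  have trV: "Re (trace (mat_powr V s)) = Re (trace Q)"
    using s by (simp add: V_def mat_powr_mat_powr posdef_imp_psd Q mat_powr_one)
  have pU: "posdef (exp t *\<^sub>R U)" for t by (simp add: posdef_scaleR U)
  have le: "exp (- r) *\<^sub>R U \<preceq> V" "V \<preceq> exp r *\<^sub>R U" using th by (auto simp: thompson_near_def U_def V_def)
  have "exp (- (r * \<bar>s\<bar>)) \<le> Re (trace Q) \<and> Re (trace Q) \<le> exp (r * \<bar>s\<bar>)"
    using s'
  proof
    assume "s < 0"
    then show ?thesis
      using trace_mat_powr_mono(2)[OF pU V le(1), of s] trace_mat_powr_mono(2)[OF V pU le(2), of s] trU[of r] trU[of "- r"]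
      by (simp add: trV)
  next
    assume "1 < s"
    then show ?thesis
      using trace_mat_powr_mono(1)[OF pU V le(1), of s] trace_mat_powr_mono(1)[OF V pU le(2), of s] trU[of r] trU[of "- r"]
      by (simp add: trV)
  qed
  then have "ln (exp (- (r * \<bar>s\<bar>))) \<le> ln (Re (trace Q))" "ln (Re (trace Q)) \<le> ln (exp (r * \<bar>s\<bar>))"
    using posdef_trace_pos[OF Q] by (simp_all only: ln_le_cancel_iff exp_gt_zero)
  then have "\<bar>ln (Re (trace Q))\<bar> \<le> r * \<bar>s\<bar>" by (simp add: abs_le_iff)
  then have "\<bar>\<alpha> - 1\<bar> * \<bar>ln (Re (trace Q))\<bar> \<le> \<bar>\<alpha> - 1\<bar> * (r * \<bar>s\<bar>)" by (intro mult_left_mono) auto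
  also have "\<dots> = r * \<bar>(1 - \<alpha>) * s\<bar>" by (simp add: abs_mult abs_minus_commute)
  finally show ?thesis by (simp add: s abs_mult)
qed

text \<open>Origin of the factor 2: normalization multiplies Q^(1-\<alpha>) by (Tr Q)^(\<alpha>-1),
  a scalar between exp (- r) and exp r.\<close>

lemma thompson_near_normalize:
  assumes Qs: "posdef Qs" "Re (trace Qs) = 1" and Q: "posdef Q"
    and th: "thompson_near r (mat_powr Qs (1 - \<alpha>)) (mat_powr Q (1 - \<alpha>))"
  shows "thompson_near (2 * r) (mat_powr Qs (1 - \<alpha>)) (mat_powr (trace_normalize Q) (1 - \<alpha>))"
proof -
  have "\<bar>(\<alpha> - 1) * ln (Re (trace Q))\<bar> \<le> r" by (rule trace_thompson_near[OF assms])
  moreover have "Re (trace Q) powr (\<alpha> - 1) = exp ((\<alpha> - 1) * ln (Re (trace Q)))"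
    using posdef_trace_pos[OF Q] by (simp add: powr_def)
  ultimately have "thompson_near r (mat_powr Q (1 - \<alpha>)) (mat_powr (trace_normalize Q) (1 - \<alpha>))"
    unfolding mat_powr_normalize[OF Q]
    by (intro thompson_near_scaleR_self posdef_imp_psd posdef_mat_powr Q) (simp_all add: abs_le_iff)
  from thompson_near_trans[OF th this] show ?thesis by simp
qed

end

section \<open>From balls to the metric, and the convergence theorem\<close>

lemma thompson_le: "0 \<le> r \<Longrightarrow> thompson_near r V U \<Longrightarrow> thompson V U \<le> ereal r"
  unfolding thompson_def thompson_near_def by (rule INF_lower) simp

text \<open>Dividing by K > 0 leaves a lower bound for the infimum, which is checked at each
  admissible radius.\<close>

lemma le_mult_thompson:
  assumes "0 < K" "\<And>r. 0 \<le> r \<Longrightarrow> thompson_near r V U \<Longrightarrow> x \<le> ereal (K * r)"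
  shows "x \<le> ereal K * thompson V U"
proof -
  have "x / ereal K \<le> thompson V U"
    unfolding thompson_def
  proof (rule INF_greatest)
    fix r assume "r \<in> {r. 0 \<le> r \<and> exp (- r) *\<^sub>R V \<preceq> U \<and> U \<preceq> exp r *\<^sub>R V}"
    then have "x \<le> ereal K * ereal r" using assms(2)[of r] by (simp add: thompson_near_def)
    then show "x / ereal K \<le> ereal r" using assms(1) by (simp add: ereal_divide_le_pos)
  qed
  then show ?thesis using assms(1) by (simp add: ereal_divide_le_pos)
qed

theorem theorem5p1:
  fixes A :: "nat \<Rightarrow> complex ^ 'n::finite ^ 'n" and w :: "nat \<Rightarrow> real" and n :: nat
    and \<alpha> :: real and Q :: "nat \<Rightarrow> complex ^ 'n ^ 'n" and Qstar :: "complex ^ 'n ^ 'n"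
  defines "F \<equiv> petz_augustin_objective n w A \<alpha>"
  assumes states_A: "\<And>j. j \<in> {1..n} \<Longrightarrow> A j \<in> states"
    and full_rank: "rank (\<Sum>j=1..n. A j) = CARD('n)"
    and weights_pos: "\<And>j. j \<in> {1..n} \<Longrightarrow> w j > 0"
    and weights_sum: "(\<Sum>j=1..n. w j) = 1"
    and alpha: "\<alpha> \<in> {1/2<..<1} \<union> {1<..}"
    and Q_init: "posdef (Q 1)" "Q 1 \<in> states"
    and Q_step: "\<And>t. t \<ge> 1 \<Longrightarrow>
      Q (t + 1) = mat_powr (petz_augustin_operator n w A \<alpha> (mat_powr (Q t) (1 - \<alpha>))) (1 / (1 - \<alpha>))"
    and minimizer: "is_arg_min F (\<lambda>R. R \<in> states) Qstar"
  shows "(\<forall>T\<ge>1.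
        F (trace_normalize (Q (T + 1))) - F Qstar
          \<le> ereal \<bar>1 / (\<alpha> - 1)\<bar> *
              thompson (mat_powr Qstar (1 - \<alpha>)) (mat_powr (trace_normalize (Q (T + 1))) (1 - \<alpha>))
      \<and> ereal \<bar>1 / (\<alpha> - 1)\<bar> *
              thompson (mat_powr Qstar (1 - \<alpha>)) (mat_powr (trace_normalize (Q (T + 1))) (1 - \<alpha>))
          \<le> ereal (\<bar>2 / (\<alpha> - 1)\<bar> * \<bar>1 - 1 / \<alpha>\<bar> ^ T) *
              thompson (mat_powr Qstar (1 - \<alpha>)) (mat_powr (Q 1) (1 - \<alpha>)))
    \<and> (\<alpha> > 1 \<longrightarrow> (\<forall>t\<ge>1. F (trace_normalize (Q (t + 1))) \<le> F (trace_normalize (Q t))))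
    \<and> thompson (mat_powr Qstar (1 - \<alpha>)) (mat_powr (Q 1) (1 - \<alpha>)) < \<infinity>"
proof -
  interpret pa: petz_augustin A w n \<alpha>
    by unfold_locales (use states_A full_rank weights_pos weights_sum alpha in auto)
  note Qs = pa.minimizer_fixed_point[OF minimizer[unfolded F_def]]
  have step: "Q (t + 1) = mat_powr (pa.S (mat_powr (Q t) (1 - \<alpha>))) (1 / \<alpha>)"
    if "1 \<le> t" "posdef (Q t)" for t
    using pa.alpha_ne unfolding Q_step[OF that(1)] pa.T_eq
    by (simp add: mat_powr_mat_powr posdef_imp_psd pa.S_posdef posdef_mat_powr that(2))
  have Q: "posdef (Q t)" if "1 \<le> t" for t
    using that
  proof (induction t rule: nat_induct_at_least)
    case (Suc t)
    then show ?case using pa.step_trace(1)[OF _ step] by simp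
  qed (rule Q_init)
  have powr_step: "mat_powr (Q (t + 1)) (1 - \<alpha>) = pa.T (mat_powr (Q t) (1 - \<alpha>))" if "1 \<le> t" for t
    using pa.step_trace(3)[OF Q[OF that] step[OF that Q[OF that]]] .
  \<comment> \<open>The centre is fixed by \<open>T\<close>, so each step shrinks the ball around
    it. Since Q 1 belongs to t = 0, the exponent t goes with Q (t + 1).\<close>
  have contr: "thompson_near (pa.\<kappa> ^ t * r) (mat_powr Qstar (1 - \<alpha>)) (mat_powr (Q (t + 1)) (1 - \<alpha>))"
    if "thompson_near r (mat_powr Qstar (1 - \<alpha>)) (mat_powr (Q 1) (1 - \<alpha>))" for t r
  proof (induction t)
    case 0
    then show ?case using that by simp
  next
    case (Suc t)
    from pa.T_thompson_near[OF posdef_mat_powr[OF Qs(1)] posdef_mat_powr[OF Q] Suc]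
    show ?case using powr_step[of "t + 1"] by (simp add: Qs(2) mult.assoc)
  qed
  have K: "0 < \<bar>1 / (\<alpha> - 1)\<bar>" using pa.alpha_ne by simp
  have "F (trace_normalize (Q t)) - F Qstar
      \<le> ereal \<bar>1 / (\<alpha> - 1)\<bar> * thompson (mat_powr Qstar (1 - \<alpha>)) (mat_powr (trace_normalize (Q t)) (1 - \<alpha>))"
    if "1 \<le> t" for t
  proof (rule le_mult_thompson[OF K])
    fix r assume r: "thompson_near r (mat_powr Qstar (1 - \<alpha>)) (mat_powr (trace_normalize (Q t)) (1 - \<alpha>))"
    note pd = trace_normalize_state(1)[OF Q[OF that]]
    define d where "d = pa.G (mat_powr (trace_normalize (Q t)) (1 - \<alpha>)) - pa.G (mat_powr Qstar (1 - \<alpha>))"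
    have "F (trace_normalize (Q t)) - F Qstar = ereal (1 / (\<alpha> - 1) * d)"
      by (simp add: F_def pa.F_posdef pd Qs(1) d_def diff_divide_distrib)
    moreover have "\<bar>d\<bar> \<le> r"
      unfolding d_def by (intro pa.G_thompson_near posdef_mat_powr pd Qs(1) r)
    then have "\<bar>1 / (\<alpha> - 1) * d\<bar> \<le> \<bar>1 / (\<alpha> - 1)\<bar> * r"
      unfolding abs_mult by (intro mult_left_mono) auto
    then have "1 / (\<alpha> - 1) * d \<le> \<bar>1 / (\<alpha> - 1)\<bar> * r" by linarith
    ultimately show "F (trace_normalize (Q t)) - F Qstar \<le> ereal (\<bar>1 / (\<alpha> - 1)\<bar> * r)" by simp
  qed
  moreover have "ereal \<bar>1 / (\<alpha> - 1)\<bar> *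
        thompson (mat_powr Qstar (1 - \<alpha>)) (mat_powr (trace_normalize (Q (t + 1))) (1 - \<alpha>))
      \<le> ereal (\<bar>2 / (\<alpha> - 1)\<bar> * \<bar>1 - 1 / \<alpha>\<bar> ^ t) *
        thompson (mat_powr Qstar (1 - \<alpha>)) (mat_powr (Q 1) (1 - \<alpha>))" for t
  proof (rule le_mult_thompson)
    \<comment> \<open>Positivity of the contraction factor uses \<alpha> \<noteq> 1.\<close>
    show "0 < \<bar>2 / (\<alpha> - 1)\<bar> * \<bar>1 - 1 / \<alpha>\<bar> ^ t"
      using pa.alpha_ne pa.kappa(2) by (intro mult_pos_pos zero_less_power) (auto simp: pa.\<kappa>_def)
    fix r :: real
    assume r: "0 \<le> r" "thompson_near r (mat_powr Qstar (1 - \<alpha>)) (mat_powr (Q 1) (1 - \<alpha>))"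
    \<comment> \<open>Contraction over t steps gives the radius \<kappa>^t r, and normalization
      doubles it.\<close>
    have "thompson (mat_powr Qstar (1 - \<alpha>)) (mat_powr (trace_normalize (Q (t + 1))) (1 - \<alpha>))
        \<le> ereal (2 * (pa.\<kappa> ^ t * r))"
      using r pa.kappa(2) Q[of "t + 1"]
      by (intro thompson_le pa.thompson_near_normalize Qs contr) auto
    from ereal_mult_left_mono[OF this, of "ereal \<bar>1 / (\<alpha> - 1)\<bar>"]
    show "ereal \<bar>1 / (\<alpha> - 1)\<bar> *
        thompson (mat_powr Qstar (1 - \<alpha>)) (mat_powr (trace_normalize (Q (t + 1))) (1 - \<alpha>))
      \<le> ereal (\<bar>2 / (\<alpha> - 1)\<bar> * \<bar>1 - 1 / \<alpha>\<bar> ^ t * r)"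
      by (simp add: pa.\<kappa>_def mult_ac)
  qed
  moreover have "F (trace_normalize (Q (t + 1))) \<le> F (trace_normalize (Q t))" if "1 < \<alpha>" "1 \<le> t" for t
    unfolding F_def using pa.F_step_antimono[OF that(1) Q[OF that(2)] step[OF that(2) Q[OF that(2)]]] .
  moreover have "thompson (mat_powr Qstar (1 - \<alpha>)) (mat_powr (Q 1) (1 - \<alpha>)) < \<infinity>"
  proof -
    obtain r where "0 \<le> r" "thompson_near r (mat_powr Qstar (1 - \<alpha>)) (mat_powr (Q 1) (1 - \<alpha>))"
      using thompson_near_exists[OF posdef_mat_powr[OF Qs(1)] posdef_mat_powr[OF Q_init(1)]] by blast
    then have "thompson (mat_powr Qstar (1 - \<alpha>)) (mat_powr (Q 1) (1 - \<alpha>)) \<le> ereal r"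
      by (rule thompson_le)
    also have "\<dots> < \<infinity>" by simp
    finally show ?thesis .
  qed
  ultimately show ?thesis by simp
qed

end
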